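(* There exists $\epsilon_0>0$ such that for every $0<\epsilon<\epsilon_0$ there are constants $c=c(\epsilon)\in(0,1)$ and $\delta=\delta(\epsilon)\in(0,1)$, depending only on $\epsilon$ (and not on $x$), such that for all $x$ sufficiently large in terms of $\epsilon$ there exists an LG set $N\subseteq\{1,2,\dots,x\}$ with parameters $\epsilon$, $c$ and $x$. Moreover, an explicit example of such a set is the following: for $x$ sufficiently large, let $N$ be the set of all integers $n\le x$ of the form $n=p_1p_2\cdots p_k$ (with $k\ge 1$ variable), where the $p_i$ are prime numbers such that $$p_1>p_2>\cdots>p_k>x^{\delta},$$ $$\frac{x}{p_1p_2\cdots p_i}\ge p_i\quad\text{for } i=1,2,\dots,k-1,\qquad\text{and}\qquad 1\le\frac{x}{p_1p_2\cdots p_k}<p_k.$$ That is, this set $N$ is an LG set with parameters $\epsilon$, $c$ and $x$.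
   Context: Definition (Local-Global set, abbreviated LG set). A set $N\subseteq\{2,3,\dots,x\}$ (the integers from $2$ up to $x$) is an LG set with parameters $\epsilon$, $c$ and $x$ if and only if the following two conditions hold: (1) for any pair of distinct members $n_1,n_2\in N$ we have $\mathrm{lcm}(n_1,n_2)>x$; (2) all but at most $\epsilon x$ of the positive integers $m\le x$ are divisible by some $n\in N$ with $n\le x^c$. *)

theory Defs
  imports Complex_Main "HOL-Computational_Algebra.Primes"
begin

definition LG_set :: "real \<Rightarrow> real \<Rightarrow> real \<Rightarrow> nat set \<Rightarrow> bool" where
  "LG_set \<epsilon> c x N \<longleftrightarrow>
     N \<subseteq> {n. 2 \<le> n \<and> real n \<le> x} \<and>
     (\<forall>n1\<in>N. \<forall>n2\<in>N. n1 \<noteq> n2 \<longrightarrow> real (lcm n1 n2) > x) \<and>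
     real (card {m::nat. 1 \<le> m \<and> real m \<le> x \<and>
                   \<not> (\<exists>n\<in>N. real n \<le> x powr c \<and> n dvd m)}) \<le> \<epsilon> * x"

(* Only the values p 1, ..., p k are relevant. *)
definition LG_example :: "real \<Rightarrow> real \<Rightarrow> nat set" where
  "LG_example \<delta> x =
     {n. real n \<le> x \<and>
         (\<exists>k\<ge>1. \<exists>p :: nat \<Rightarrow> nat.
            n = (\<Prod>j=1..k. p j) \<and>
            (\<forall>i\<in>{1..k}. prime (p i)) \<and>
            (\<forall>i\<in>{1..<k}. p i > p (i + 1)) \<and>
            real (p k) > x powr \<delta> \<and>
            (\<forall>i\<in>{1..<k}. x / real (\<Prod>j=1..i. p j) \<ge> real (p i)) \<and>
            1 \<le> x / real (\<Prod>j=1..k. p j) \<and>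
            x / real (\<Prod>j=1..k. p j) < real (p k))}"

end

(*
  The prime sequences of distinct n1, n2 in the example are not prefixes of each other.  If they first
  differ at primes p > q in the same position, p from n1 and q from n2, then p does not
  divide n2, so lcm n1 n2 >= p * n2, and p * n2 > x because p exceeds the last prime of n2.

  For the covering property let S_w(m) be the w-smooth part of m.  Apart from few m <= x with
  m <= e*x, or with p^2 dividing m for a prime p > x^\<delta>, or with S_w(m) < x^(1-c) for
  w ~ x^\<delta>, every m with S_w(m) <= e*w for some w >= x^\<delta> is covered: listing the primes
  p_1 > p_2 > ... of m beyond w, the remaining cofactor is smaller than the last prime.  So it
  suffices that few m have S_w(m) > e*w at all the scales w_0, w_1 = w_0^60, w_2 = w_1^60, ..., w_J.
  An upper bound sieve transfers this to the measure giving weight 1/s to the w_J-smooth numbers s,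
  under which the contributions of disjoint ranges of primes are independent.  There, passing from
  scale w to w^60, with probability bounded below no prime in (w, w^60] occurs; unless ln S_w is much
  larger than its average this yields S_{w^60} <= e*w^60.  Mass and first logarithmic moment of the
  bad set obey a linear recursion which contracts, so the bad proportion decays exponentially in J.
*)
theory Submission
  imports Defs "HOL-Analysis.Harmonic_Numbers" "HOL-Number_Theory.Prime_Powers"
    "HOL-Real_Asymp.Real_Asymp"
begin

section \<open>Chebyshev and Mertens type bounds\<close>

lemma card_multiples:
  assumes "d > 0" shows "card {m\<in>{1..n::nat}. d dvd m} = n div d"
proof -
  have "bij_betw (\<lambda>k. d * k) {1..n div d} {m\<in>{1..n}. d dvd m}"
    using assms by (intro bij_betw_byWitness[where f' = "\<lambda>m. m div d"])
      (auto simp: less_eq_div_iff_mult_less_eq mult.commute Suc_le_eq elim!: dvdE)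
  thus ?thesis using bij_betw_same_card by fastforce
qed

text \<open>Legendre's identity: expand each \<open>ln m\<close> as a divisor sum of
  \<open>mangoldt\<close>, then count the multiples of each \<open>d\<close>.\<close>

lemma sum_mangoldt_div: "(\<Sum>d=1..n. mangoldt d * real (n div d)) = ln (fact n)"
proof -
  have "ln (fact n :: real) = (\<Sum>m=1..n. ln (real m))"
    unfolding fact_prod of_nat_prod by (subst ln_prod) auto
  also have "\<dots> = (\<Sum>m=1..n. \<Sum>d | d \<in> {1..n} \<and> d dvd m. mangoldt d)"
  proof (intro sum.cong refl)
    fix m assume m: "m \<in> {1..n}"
    hence "{d. d dvd m} = {d. d \<in> {1..n} \<and> d dvd m}"
      by (auto simp: Suc_le_eq intro: Nat.gr0I dest: dvd_imp_le)
    thus "ln (real m) = (\<Sum>d | d \<in> {1..n} \<and> d dvd m. mangoldt d)"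
      using mangoldt_sum[of m, where ?'a = real] m by auto
  qed
  also have "\<dots> = (\<Sum>d=1..n. \<Sum>m | m \<in> {1..n} \<and> d dvd m. mangoldt d)"
    by (rule sum.swap_restrict) auto
  also have "\<dots> = (\<Sum>d=1..n. mangoldt d * real (n div d))"
  proof (intro sum.cong refl)
    fix d assume "d \<in> {1..n}"
    thus "(\<Sum>m | m \<in> {1..n} \<and> d dvd m. mangoldt d) = mangoldt d * real (n div d)"
      using card_multiples[of d n] by simp
  qed
  finally show ?thesis ..
qed

definition psi :: "nat \<Rightarrow> real" where
  "psi n = (\<Sum>d=1..n. mangoldt d)"

text \<open>Chebyshev's argument: the logarithm of the central binomial coefficient is at most
  \<open>2 * n * ln 2\<close>, and in its expansion over \<open>mangoldt d\<close> all coefficients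
  are nonnegative, those with \<open>n < d \<le> 2 * n\<close> at least 1.\<close>

lemma psi_double: "psi (2 * n) \<le> psi n + 2 * real n * ln 2"
proof -
  \<comment> \<open>\<open>n div d = 0\<close> for \<open>d > n\<close>, so the expansions of both
    factorials can run over \<open>{1..2*n}\<close>.\<close>
  have *: "(\<Sum>d=1..2*n. mangoldt d * (real (n div d))) = (\<Sum>d=1..n. mangoldt d * real (n div d))"
    by (rule sum.mono_neutral_right) auto
  have "psi (2 * n) - psi n = (\<Sum>d\<in>{n+1..2*n}. mangoldt d)"
  proof -
    have "{1..2*n} = {1..n} \<union> {n+1..2*n}" by auto
    thus ?thesis unfolding psi_def by (simp add: sum.union_disjoint)
  qed
  also have "\<dots> \<le> (\<Sum>d\<in>{n+1..2*n}. mangoldt d * (real (2*n div d) - 2 * real (n div d)))"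
  proof (intro sum_mono)
    fix d assume "d \<in> {n+1..2*n}"
    hence "2*n div d \<ge> 1" "n div d = 0" by (auto simp: Suc_le_eq div_greater_zero_iff)
    thus "mangoldt d \<le> mangoldt d * (real (2*n div d) - 2 * real (n div d))"
      using mangoldt_nonneg[of d] mult_left_mono[of 1 "real (2*n div d)" "mangoldt d"] by simp
  qed
  also have "\<dots> \<le> (\<Sum>d\<in>{1..2*n}. mangoldt d * (real (2*n div d) - 2 * real (n div d)))"
  proof (intro sum_mono2)
    fix d assume "d \<in> {1..2*n} - {n+1..2*n}"
    hence "d > 0" by auto
    have "2 * (n div d) \<le> (2 * n) div d"
      using \<open>d > 0\<close> by (simp add: less_eq_div_iff_mult_less_eq)
    thus "0 \<le> mangoldt d * (real (2*n div d) - 2 * real (n div d))"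
      using mangoldt_nonneg[of d] by (simp flip: of_nat_mult)
  qed auto
  also have "\<dots> = ln (fact (2*n)) - 2 * ln (fact n)"
    unfolding sum_mangoldt_div[symmetric] *[symmetric]
    by (simp add: algebra_simps sum_subtractf sum_distrib_left)
  also have "\<dots> = ln (real ((2*n) choose n))"
    by (simp add: binomial_fact ln_div ln_mult)
  also have "\<dots> \<le> ln (2 ^ (2*n))"
    using binomial_le_pow2[of "2*n" n] by (subst ln_le_cancel_iff) (auto simp flip: of_nat_le_iff)
  also have "\<dots> = 2 * real n * ln 2" by (simp add: ln_realpow)
  finally show ?thesis by simp
qed

text \<open>Halving: with \<open>k = n div 2\<close>, doubling adds at most \<open>2 * k\<close>,
  and an odd \<open>n\<close> adds one further term of at most \<open>n - 1 = 2 * k\<close>, so the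
  total stays below \<open>8 * k\<close>.\<close>

lemma psi_le: "psi n \<le> 4 * real n"
proof (induction n rule: less_induct)
  case (less n)
  define k where "k = n div 2"
  show ?case
  proof (cases "n = 0")
    case False
    hence "psi k \<le> 4 * real k" by (intro less) (auto simp: k_def)
    hence "psi (2*k) \<le> 4 * real k + 2 * real k * ln 2" using psi_double[of k] by simp
    moreover have "real k * ln 2 \<le> real k * 1" by (intro mult_left_mono) (use ln_2_less_1 in auto)
    ultimately have e: "psi (2*k) \<le> 6 * real k" by simp
    show ?thesis
    proof (cases "even n")
      case True
      thus ?thesis using e by (auto simp: k_def)
    next
      case False
      hence n: "n = Suc (2*k)" by (auto simp: k_def)
      have "psi n = psi (2*k) + mangoldt n" by (simp add: n psi_def)
      moreover have "mangoldt n \<le> ln (real n)" by (rule mangoldt_le) (simp add: n)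
      moreover have "ln (real n) \<le> real n - 1" by (rule ln_le_minus_one) (simp add: n)
      ultimately show ?thesis using e n by simp
    qed
  qed (simp add: psi_def)
qed

text \<open>Upper half of Mertens' first theorem: replacing \<open>n div d\<close> by
  \<open>n / d\<close> in the expansion of \<open>ln (fact n)\<close> costs at most
  \<open>psi n\<close>.\<close>

lemma sum_mangoldt_over_le:
  assumes "n > 0" shows "(\<Sum>d=1..n. mangoldt d / real d) \<le> ln (real n) + 4"
proof -
  have "real n * (\<Sum>d=1..n. mangoldt d / real d) = (\<Sum>d=1..n. mangoldt d * (real n / real d))"
    by (simp add: sum_distrib_left field_simps)
  also have "\<dots> \<le> (\<Sum>d=1..n. mangoldt d * (real (n div d) + 1))"
  proof (intro sum_mono mult_left_mono mangoldt_nonneg)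
    fix d assume "d \<in> {1..n}"
    show "real n / real d \<le> real (n div d) + 1"
      using floor_correct[of "real n / real d"] by (simp add: floor_divide_of_nat_eq)
  qed
  also have "\<dots> = ln (fact n) + psi n"
    by (simp add: algebra_simps sum.distrib psi_def flip: sum_mangoldt_div)
  also have "ln (fact n) \<le> ln (real n ^ n)"
    using fact_le_power[of n, where 'a = real] assms by (subst ln_le_cancel_iff) auto
  also have "\<dots> = real n * ln (real n)" using assms by (simp add: ln_realpow)
  also have "real n * ln (real n) + psi n \<le> real n * (ln (real n) + 4)"
    using psi_le[of n] by (simp add: algebra_simps)
  finally show ?thesis using assms by simp
qed

definition primes_in :: "nat \<Rightarrow> nat \<Rightarrow> nat set" where
  "primes_in a b = {p. prime p \<and> a < p \<and> p \<le> b}"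

lemma finite_primes_in [simp, intro]: "finite (primes_in a b)"
  by (rule finite_subset[of _ "{..b}"]) (auto simp: primes_in_def)

text \<open>For a finite set of primes, the expectation of \<open>ln s\<close> when a number
  \<open>s\<close> composed of primes from \<open>P\<close> is drawn with probability proportional
  to \<open>1 / s\<close>: the exponent of \<open>p\<close> is then geometric with mean
  \<open>1 / (p - 1)\<close>.\<close>

definition log_sum :: "nat set \<Rightarrow> real" where
  "log_sum P = (\<Sum>p\<in>P. ln (real p) / (real p - 1))"

text \<open>The normalising factor of that distribution: the reciprocal of the sum of all
  \<open>1 / s\<close>.\<close>

definition euler_prod :: "nat set \<Rightarrow> real" where
  "euler_prod P = (\<Prod>p\<in>P. 1 - 1 / real p)"

text \<open>Follows from the Mertens bound through \<open>1 / (p - 1) \<le> 2 / p\<close>; the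
  constant 14 absorbs the additive 8, as \<open>ln w \<ge> 2 / 3\<close>.\<close>

lemma log_sum_le:
  assumes "w \<ge> 2" shows "log_sum (primes_in a w) \<le> 14 * ln (real w)"
proof -
  have ln2: "ln (real w) \<ge> 2/3"
    using ln2_ge_two_thirds ln_mono[of 2 "real w"] assms by linarith
  have "log_sum (primes_in a w) \<le> (\<Sum>p\<in>primes_in a w. 2 * (mangoldt p / real p))"
    unfolding log_sum_def
  proof (intro sum_mono)
    fix p assume "p \<in> primes_in a w"
    hence p: "prime p" "real p \<ge> 2" by (auto simp: primes_in_def dest: prime_ge_2_nat)
    hence "1 / (real p - 1) \<le> 2 / real p" by (simp add: field_simps)
    hence "ln (real p) * (1 / (real p - 1)) \<le> ln (real p) * (2 / real p)"
      using p by (intro mult_left_mono) auto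
    thus "ln (real p) / (real p - 1) \<le> 2 * (mangoldt p / real p)" using p by (simp add: mult.commute)
  qed
  also have "\<dots> \<le> (\<Sum>d=1..w. 2 * (mangoldt d / real d))"
    by (intro sum_mono2) (auto simp: primes_in_def mangoldt_nonneg Suc_le_eq prime_gt_0_nat)
  also have "\<dots> = 2 * (\<Sum>d=1..w. mangoldt d / real d)" by (simp add: sum_distrib_left)
  also have "\<dots> \<le> 2 * (ln (real w) + 4)" using sum_mangoldt_over_le[of w] assms by simp
  also have "\<dots> \<le> 14 * ln (real w)" using ln2 by simp
  finally show ?thesis .
qed

section \<open>Reciprocal sums over integers composed of given primes\<close>

lemma euler_prod_pos: 
  assumes "\<And>p. p \<in> P \<Longrightarrow> prime p"
  shows "euler_prod P > 0"
  unfolding euler_prod_def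
proof (rule prod_pos)
  fix p assume "p \<in> P"
  hence "p > 1" using assms prime_gt_1_nat by blast
  thus "0 < 1 - 1 / real p" by simp
qed

lemma log_sum_nonneg: 
  assumes "\<And>p. p \<in> P \<Longrightarrow> prime p"
  shows "log_sum P \<ge> 0"
  unfolding log_sum_def
proof (rule sum_nonneg)
  fix p assume "p \<in> P"
  hence "p > 1" using assms prime_gt_1_nat by blast
  thus "0 \<le> ln (real p) / (real p - 1)" by simp
qed

lemma sum_geometric_le:
  fixes q :: real assumes "0 \<le> q" "q < 1"
  shows "(\<Sum>k\<le>K. q ^ k) \<le> 1 / (1 - q)" "(\<Sum>k\<le>K. real k * q ^ k) \<le> q / (1 - q)\<^sup>2"
proof -
  have "(\<Sum>k\<in>{..K}. q ^ k) \<le> suminf (\<lambda>k. q ^ k)"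
    using assms by (intro sum_le_suminf summable_geometric) auto
  thus "(\<Sum>k\<le>K. q ^ k) \<le> 1 / (1 - q)" using assms by (simp add: suminf_geometric)
  have s: "(\<lambda>k. real (Suc k) * q ^ k) sums (1 / (1 - q)\<^sup>2)"
    using geometric_deriv_sums[of q] assms by simp
  have "(\<Sum>k\<le>K. real k * q ^ k) \<le> (\<Sum>k\<le>Suc K. real k * q ^ k)"
    using assms by (intro sum_mono2) auto
  also have "\<dots> = q * (\<Sum>k\<in>{..K}. real (Suc k) * q ^ k)"
    by (subst sum.atMost_Suc_shift) (simp add: sum_distrib_left algebra_simps)
  also have "(\<Sum>k\<in>{..K}. real (Suc k) * q ^ k) \<le> 1 / (1 - q)\<^sup>2"
    using sum_le_suminf[of "\<lambda>k. real (Suc k) * q ^ k" "{..K}"] s assms by (auto simp: sums_iff)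
  finally show "(\<Sum>k\<le>K. real k * q ^ k) \<le> q / (1 - q)\<^sup>2" using assms by (simp add: mult_left_mono)
qed

text \<open>Induction on \<open>P\<close>: split the power \<open>p ^ k\<close> off each
  \<open>m\<close> and sum two series of geometric type over \<open>k\<close>. The split adds
  \<open>k * ln p\<close> to the logarithm, which moves into the constant term; hence
  \<open>\<alpha>\<close> stays arbitrary in the induction.\<close>

lemma sum_over_P_numbers_le:
  fixes M :: "nat set"
  assumes "finite P" "\<And>p. p \<in> P \<Longrightarrow> prime p" "finite M"
    and "\<And>m. m \<in> M \<Longrightarrow> m > 0 \<and> prime_factors m \<subseteq> P" and "\<alpha> \<ge> 0" "\<beta> \<ge> 0"
  shows "(\<Sum>m\<in>M. (\<alpha> + \<beta> * ln (real m)) / real m) \<le> (\<alpha> + \<beta> * log_sum P) / euler_prod P"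
  using assms
proof (induction P arbitrary: M \<alpha> rule: finite_induct)
  case empty
  have "m = 1" if "m \<in> M" for m
    using empty.prems(3)[OF that] by (auto simp: prime_factorization_empty_iff)
  hence "M \<subseteq> {1}" by auto
  hence "(\<Sum>m\<in>M. (\<alpha> + \<beta> * ln (real m)) / real m) \<le> (\<Sum>m\<in>{1::nat}. (\<alpha> + \<beta> * ln (real m)) / real m)"
    using empty.prems by (intro sum_mono2) auto
  thus ?case by (simp add: log_sum_def euler_prod_def)
next
  case (insert p P)
  have p: "prime p" using insert.prems by auto
  hence p1: "real p > 1" using prime_gt_1_nat by simp
  define q where "q = 1 / real p"
  have q: "0 \<le> q" "q < 1" using p1 by (auto simp: q_def)
  define \<kappa> where "\<kappa> m = multiplicity p m" for m
  define \<nu> where "\<nu> m = m div p ^ \<kappa> m" for m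
  define M' where "M' = \<nu> ` M"
  \<comment> \<open>Inserting 0 keeps \<open>Max\<close> meaningful for empty
    \<open>M\<close>.\<close>
  define K where "K = Max (insert 0 (\<kappa> ` M))"
  define h where "h m = (\<alpha> + \<beta> * ln (real m)) / real m" for m
  define R where "R = 1 / euler_prod P"
  define E where "E = log_sum P"
  have decomp: "m = p ^ \<kappa> m * \<nu> m" for m
    by (simp add: \<nu>_def \<kappa>_def multiplicity_dvd)
  have \<nu>: "\<nu> m > 0 \<and> prime_factors (\<nu> m) \<subseteq> P" if "m \<in> M" for m
  proof -
    have m: "m > 0" "prime_factors m \<subseteq> insert p P" using insert.prems(3)[OF that] by auto
    have pos: "\<nu> m > 0" using decomp[of m] m(1) by (metis gr0I mult_0_right)
    have "\<not> p dvd \<nu> m" unfolding \<nu>_def \<kappa>_def using p m(1)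
      by (intro multiplicity_decompose) (auto dest: prime_gt_1_nat)
    moreover have "\<nu> m dvd m" using decomp[of m] by (metis dvd_triv_right)
    hence "prime_factors (\<nu> m) \<subseteq> insert p P"
      using m dvd_prime_factors[of m "\<nu> m"] by auto
    ultimately show ?thesis using pos by auto
  qed
  have h0: "h (p ^ k * n) \<ge> 0" if "n > 0" for k n
  proof -
    have "p ^ k * n > 0" using that p by (simp add: prime_gt_0_nat)
    hence "real (p ^ k * n) \<ge> 1" by linarith
    thus ?thesis using insert.prems(4,5) unfolding h_def
      by (intro divide_nonneg_nonneg add_nonneg_nonneg mult_nonneg_nonneg ln_ge_zero) auto
  qed
  have "(\<Sum>m\<in>M. h m) = (\<Sum>(k,n)\<in>(\<lambda>m. (\<kappa> m, \<nu> m)) ` M. h (p ^ k * n))"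
  proof (subst sum.reindex)
    show "inj_on (\<lambda>m. (\<kappa> m, \<nu> m)) M" by (rule inj_onI) (metis decomp prod.inject)
  qed (simp add: decomp[symmetric])
  also have "\<dots> \<le> (\<Sum>(k,n)\<in>{..K} \<times> M'. h (p ^ k * n))"
    using insert.prems(2) \<nu> by (intro sum_mono2) (auto simp: K_def M'_def intro!: h0 Max_ge)
  also have "\<dots> = (\<Sum>k\<le>K. \<Sum>n\<in>M'. h (p ^ k * n))" by (simp add: sum.cartesian_product)
  also have "\<dots> \<le> (\<Sum>k\<le>K. q ^ k * ((\<alpha> + \<beta> * (real k * ln p) + \<beta> * E) * R))"
  proof (intro sum_mono)
    fix k
    have "(\<Sum>n\<in>M'. h (p ^ k * n)) = q ^ k * (\<Sum>n\<in>M'. ((\<alpha> + \<beta> * (real k * ln p)) + \<beta> * ln (real n)) / real n)"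
      unfolding sum_distrib_left
    proof (intro sum.cong refl)
      fix n assume "n \<in> M'"
      hence "n > 0" using \<nu> by (auto simp: M'_def)
      thus "h (p ^ k * n) = q ^ k * (((\<alpha> + \<beta> * (real k * ln p)) + \<beta> * ln (real n)) / real n)"
        using p1 by (simp add: h_def q_def ln_mult ln_realpow power_divide field_simps)
    qed
    also have "\<dots> \<le> q ^ k * ((\<alpha> + \<beta> * (real k * ln p) + \<beta> * log_sum P) / euler_prod P)"
      using insert.prems \<nu> p1 q by (intro mult_left_mono insert.IH) (auto simp: M'_def)
    finally show "(\<Sum>n\<in>M'. h (p ^ k * n)) \<le> q ^ k * ((\<alpha> + \<beta> * (real k * ln p) + \<beta> * E) * R)"
      by (simp add: R_def E_def)
  qed
  also have "\<dots> = ((\<alpha> + \<beta> * E) * (\<Sum>k\<le>K. q ^ k) + \<beta> * ln p * (\<Sum>k\<le>K. real k * q ^ k)) * R"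
    by (simp add: sum_distrib_left sum_distrib_right sum.distrib algebra_simps)
  also have "\<dots> \<le> ((\<alpha> + \<beta> * E) * (1 / (1 - q)) + \<beta> * ln p * (q / (1 - q)\<^sup>2)) * R"
  proof (intro mult_right_mono add_mono mult_left_mono sum_geometric_le q)
    have "E \<ge> 0" unfolding E_def using insert.prems(1) by (intro log_sum_nonneg) auto
    thus "\<alpha> + \<beta> * E \<ge> 0" using insert.prems by simp
    show "R \<ge> 0" using euler_prod_pos[of P] insert.prems by (simp add: R_def)
  qed (use insert.prems p1 in auto)
  also have "\<dots> = (\<alpha> + \<beta> * E + \<beta> * (ln p * (q / (1 - q)))) / (1 - q) * R"
    by (simp add: divide_inverse power2_eq_square distrib_left distrib_right mult_ac)
  also have "q / (1 - q) = 1 / (real p - 1)" using p1 by (simp add: q_def field_simps)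
  also have "(\<alpha> + \<beta> * E + \<beta> * (ln p * (1 / (real p - 1)))) / (1 - q) * R =
     (\<alpha> + \<beta> * log_sum (insert p P)) / euler_prod (insert p P)"
  proof -
    have "log_sum (insert p P) = 1 / (real p - 1) * ln p + E"
      using insert.hyps by (simp add: log_sum_def E_def)
    moreover have "euler_prod (insert p P) = (1 - q) * euler_prod P"
      using insert.hyps by (simp add: euler_prod_def q_def)
    ultimately show ?thesis
      by (simp add: R_def divide_inverse distrib_left distrib_right mult_ac add_ac)
  qed
  finally show ?case by (simp add: h_def)
qed

lemma euler_prod_union:
  assumes "finite P" "finite Q" "P \<inter> Q = {}"
  shows "euler_prod (P \<union> Q) = euler_prod P * euler_prod Q"
  using assms unfolding euler_prod_def by (simp add: prod.union_disjoint)

lemma euler_prod_primes_split: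
  assumes "a \<le> b" "b \<le> c"
  shows "euler_prod (primes_in a c) = euler_prod (primes_in a b) * euler_prod (primes_in b c)"
proof -
  have "primes_in a c = primes_in a b \<union> primes_in b c" using assms by (auto simp: primes_in_def)
  moreover have "primes_in a b \<inter> primes_in b c = {}" by (auto simp: primes_in_def)
  ultimately show ?thesis using euler_prod_union by simp
qed

lemma euler_prod_primes_pos [simp]: "euler_prod (primes_in a b) > 0"
  by (rule euler_prod_pos) (auto simp: primes_in_def)

lemma sum_inverse_le_euler_prod:
  assumes "finite M" "\<And>m. m \<in> M \<Longrightarrow> m > 0 \<and> prime_factors m \<subseteq> primes_in a b"
  shows "(\<Sum>m\<in>M. 1 / real m) \<le> 1 / euler_prod (primes_in a b)"
proof -
  have "prime p" if "p \<in> primes_in a b" for p using that by (simp add: primes_in_def)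
  from sum_over_P_numbers_le[OF finite_primes_in this assms, of 1 0] show ?thesis by simp
qed

lemma prime_factors_subset_primes_in:
  assumes "0 < m" "m \<le> b" "\<And>p. prime p \<Longrightarrow> p dvd m \<Longrightarrow> a < p"
  shows "prime_factors m \<subseteq> primes_in a b"
  using assms by (auto simp: primes_in_def prime_factors_dvd dest: dvd_imp_le)

text \<open>Every \<open>m \<le> w\<close> is composed of primes up to \<open>w\<close>, so the
  harmonic sum, which is at least \<open>ln w\<close>, is bounded by the reciprocal of the Euler
  product.\<close>

lemma ln_euler_prod_le: 
  assumes "w > 0" shows "ln (real w) * euler_prod (primes_in 0 w) \<le> 1"
proof -
  have "ln (real w) \<le> (\<Sum>m\<in>{1..w}. 1 / real m)"
    using ln_le_harm[of w] assms unfolding harm_def 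
    by (smt (verit) inverse_eq_divide ln_mono of_nat_0_less_iff sum.cong)
  also have "\<dots> \<le> 1 / euler_prod (primes_in 0 w)"
  proof (intro sum_inverse_le_euler_prod)
    fix m assume "m \<in> {1..w}"
    thus "m > 0 \<and> prime_factors m \<subseteq> primes_in 0 w"
      using prime_factors_subset_primes_in[of m w 0] prime_gt_0_nat by auto
  qed auto
  finally show ?thesis by (simp add: field_simps)
qed

lemma one_minus_powr_nonneg:
  assumes "prime (p::nat)" "\<sigma> > 0" shows "0 \<le> 1 - real p powr - (1 + \<sigma>)"
proof -
  have "real p \<ge> 1" using prime_ge_1_nat[OF assms(1)] by simp
  thus ?thesis using powr_mono[of "- (1 + \<sigma>)" 0 "real p"] assms(2) by simp
qed

section \<open>Lower bound for the Euler product\<close>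

text \<open>The comparison of a term of the zeta series with an integral over the unit interval
  before it, in telescoping form; it is derived from \<open>1 + u \<le> exp u\<close>.\<close>

lemma powr_neg_le_diff:
  assumes "\<sigma> > 0" 
  shows "real (Suc (Suc n)) powr -(1 + \<sigma>) \<le> (real (Suc n) powr -\<sigma> - real (Suc (Suc n)) powr -\<sigma>) / \<sigma>"
proof -
  define x where "x = real (Suc (Suc n))"
  have x: "x \<ge> 2" by (simp add: x_def)
  have "ln (1 - 1 / x) \<le> - 1 / x" using ln_le_minus_one[of "1 - 1 / x"] x by simp
  hence "\<sigma> * (1 / x) \<le> \<sigma> * - ln (1 - 1 / x)" using assms by (intro mult_left_mono) auto
  hence "1 + \<sigma> / x \<le> 1 + - \<sigma> * ln (1 - 1 / x)" by simp
  also have "\<dots> \<le> exp (- \<sigma> * ln (1 - 1 / x))" by (rule exp_ge_add_one_self)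
  also have "\<dots> = (1 - 1 / x) powr -\<sigma>" using x by (simp add: powr_def)
  finally have "x powr -\<sigma> * (1 + \<sigma> / x) \<le> x powr -\<sigma> * (1 - 1 / x) powr -\<sigma>"
    by (rule mult_left_mono) auto
  also have "\<dots> = (x * (1 - 1 / x)) powr -\<sigma>" using x by (subst powr_mult) auto
  also have "x * (1 - 1 / x) = real (Suc n)" using x by (simp add: field_simps x_def)
  finally have "x powr -\<sigma> / x \<le> (real (Suc n) powr -\<sigma> - x powr -\<sigma>) / \<sigma>"
    using assms by (simp add: field_simps)
  moreover have "x powr -\<sigma> / x = x powr -(1 + \<sigma>)" 
    using x powr_diff[of x "-\<sigma>" 1] by (simp add: minus_diff_commute)
  ultimately show ?thesis by (simp add: x_def)
qed

lemma sum_powr_neg_le: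
  assumes "\<sigma> > 0"
  shows "(\<Sum>n<N. real (Suc n) powr -(1 + \<sigma>)) \<le> 1 + 1 / \<sigma>"
proof -
  have "(\<Sum>n<Suc N. real (Suc n) powr -(1 + \<sigma>)) \<le> 1 + (1 - real (Suc N) powr -\<sigma>) / \<sigma>" for N
  proof (induction N)
    case (Suc N)
    from add_mono[OF Suc.IH powr_neg_le_diff[OF assms, of N]] show ?case
      by (simp add: add_divide_distrib diff_divide_distrib)
  qed simp
  also have "1 + (1 - real (Suc N) powr -\<sigma>) / \<sigma> \<le> 1 + 1 / \<sigma>" for N
    using assms by (simp add: divide_right_mono)
  finally have *: "(\<Sum>n<Suc N. real (Suc n) powr -(1 + \<sigma>)) \<le> 1 + 1 / \<sigma>" for N .
  show ?thesis
  proof (cases N)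
    case (Suc k)
    thus ?thesis using *[of k] by simp
  qed (use assms in auto)
qed

text \<open>Removing the multiples of one further prime \<open>p\<close> multiplies the series by \<open>1 - p powr -s\<close>.\<close>
lemma sums_coprime_powr:
  fixes P :: "nat set"
  assumes "finite P" "\<And>p. p \<in> P \<Longrightarrow> prime p" "(\<lambda>n. real n powr - s) sums Z"
  shows "(\<lambda>n. if \<forall>p\<in>P. \<not> p dvd n then real n powr - s else 0) sums (Z * (\<Prod>p\<in>P. 1 - real p powr - s))"
  using assms(1,2)
proof (induction P rule: finite_induct)
  case empty
  thus ?case using assms(3) by simp
next
  case (insert p P)
  define g where "g n = (if \<forall>p\<in>P. \<not> p dvd n then real n powr - s else 0)" for n
  define Y where "Y = Z * (\<Prod>p\<in>P. 1 - real p powr - s)"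
  have p: "prime p" using insert.prems by simp
  have g: "g sums Y" using insert unfolding g_def Y_def by simp
  have gp: "g (p * n) = real p powr - s * g n" for n
  proof -
    have "q dvd p * n \<longleftrightarrow> q dvd n" if "q \<in> P" for q
      using that insert p by (metis insertCI prime_dvd_mult_iff primes_dvd_imp_eq)
    thus ?thesis by (auto simp: g_def powr_mult)
  qed
  have "(\<lambda>n. g (p * n)) sums (real p powr - s * Y)"
    unfolding gp by (intro sums_mult g)
  hence "(\<lambda>n. (if p dvd n then g n else 0) ) sums (real p powr - s * Y)"
    using sums_mono_reindex[of "\<lambda>n. p * n" "\<lambda>n. if p dvd n then g n else 0"] prime_gt_0_nat[OF p]
    by (fastforce simp: strict_mono_def image_iff elim!: dvdE)
  from sums_diff[OF g this]
  have "(\<lambda>n. g n - (if p dvd n then g n else 0)) sums (Y * (1 - real p powr - s))"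
    by (simp add: algebra_simps)
  also have "(\<lambda>n. g n - (if p dvd n then g n else 0)) =
     (\<lambda>n. if \<forall>p\<in>insert p P. \<not> p dvd n then real n powr - s else 0)"
    by (auto simp: g_def fun_eq_iff)
  also have "Y * (1 - real p powr - s) = Z * (\<Prod>p\<in>insert p P. 1 - real p powr - s)"
    using insert.hyps by (simp add: Y_def)
  finally show ?case .
qed

text \<open>The terms of the zeta series at \<open>1 + \<sigma>\<close> with \<open>n\<close>
  coprime to \<open>P\<close> sum to zeta times the product, and \<open>n = 1\<close> alone
  contributes 1. Zeta itself is at most \<open>1 + 1 / \<sigma>\<close>.\<close>

lemma prod_one_minus_powr_ge:
  fixes P :: "nat set"
  assumes "finite P" "\<And>p. p \<in> P \<Longrightarrow> prime p" "\<sigma> > 0"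
  shows "1 \<le> (1 + 1 / \<sigma>) * (\<Prod>p\<in>P. 1 - real p powr - (1 + \<sigma>))"
proof -
  define f where "f n = real n powr - (1 + \<sigma>)" for n
  have sm: "summable (\<lambda>n. f (Suc n))"
    unfolding f_def by (intro summableI_nonneg_bounded[OF _ sum_powr_neg_le[OF assms(3)]]) simp
  hence f: "summable f" by (simp add: summable_Suc_iff)
  \<comment> \<open>\<open>0 powr\<close> anything is 0, so the index 0 contributes nothing to the
    series.\<close>
  have f0: "f 0 = 0" by (simp add: f_def)
  have Z: "suminf f \<le> 1 + 1 / \<sigma>"
  proof -
    have "suminf f = (\<Sum>n. f (Suc n))" using suminf_split_head[OF f] f0 by simp
    also have "\<dots> \<le> 1 + 1 / \<sigma>" 
      using sum_powr_neg_le[OF assms(3)] sm unfolding f_def by (intro suminf_le_const) auto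
    finally show ?thesis .
  qed
  define g where "g = (\<lambda>n::nat. if \<forall>p\<in>P. \<not> p dvd n then f n else 0)"
  have g: "g sums (suminf f * (\<Prod>p\<in>P. 1 - real p powr - (1 + \<sigma>)))"
    using sums_coprime_powr[OF assms(1,2), of "1 + \<sigma>"] f unfolding g_def f_def by (auto simp: summable_sums)
  have "1 \<notin> P" using assms(2) not_prime_1 by blast
  hence "1 = g 1" by (simp add: g_def f_def)
  also have "\<dots> \<le> suminf g"
    using sum_le_suminf[of g "{1}"] g by (auto simp: sums_iff g_def f_def)
  also have "\<dots> = suminf f * (\<Prod>p\<in>P. 1 - real p powr - (1 + \<sigma>))" using g by (simp add: sums_iff)
  also have "\<dots> \<le> (1 + 1 / \<sigma>) * (\<Prod>p\<in>P. 1 - real p powr - (1 + \<sigma>))"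
    using assms by (intro mult_right_mono Z prod_nonneg one_minus_powr_nonneg)
  finally show ?thesis .
qed

text \<open>The exponent is \<open>\<sigma>\<close> times the term of \<open>log_sum\<close> at
  \<open>p\<close>, so that multiplying over \<open>p\<close> compares whole Euler products at
  \<open>1 + \<sigma>\<close> and 1.\<close>

lemma one_minus_powr_le:
  assumes "prime (p::nat)" "\<sigma> > 0"
  shows "1 - real p powr - (1 + \<sigma>) \<le> (1 - 1 / real p) * exp (\<sigma> * (ln (real p) / (real p - 1)))"
proof -
  have p: "real p > 1" using prime_gt_1_nat[OF assms(1)] by simp
  have "1 - real p powr - \<sigma> \<le> \<sigma> * ln (real p)"
    using exp_ge_add_one_self[of "- \<sigma> * ln (real p)"] p by (simp add: powr_def)
  hence le: "(1 - real p powr - \<sigma>) / real p \<le> (1 - 1 / real p) * (\<sigma> * ln (real p) / (real p - 1))"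
  proof -
    have "(1 - 1 / real p) * (\<sigma> * ln (real p) / (real p - 1)) = \<sigma> * ln (real p) / real p"
      using p by (simp add: divide_simps) 
    thus ?thesis using \<open>1 - real p powr - \<sigma> \<le> \<sigma> * ln (real p)\<close> p by (simp add: divide_right_mono)
  qed
  have "real p powr - (1 + \<sigma>) = real p powr - \<sigma> / real p"
    using p powr_diff[of "real p" "-\<sigma>" 1] by (simp add: minus_diff_commute)
  hence "1 - real p powr - (1 + \<sigma>) = (1 - 1 / real p) + (1 - real p powr - \<sigma>) / real p"
    by (simp add: diff_divide_distrib)
  also have "\<dots> \<le> (1 - 1 / real p) * (1 + \<sigma> * (ln (real p) / (real p - 1)))"
    using le by (simp add: algebra_simps)
  also have "\<dots> \<le> (1 - 1 / real p) * exp (\<sigma> * (ln (real p) / (real p - 1)))"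
    using p by (intro mult_left_mono exp_ge_add_one_self) auto
  finally show ?thesis .
qed

text \<open>Compare the Euler product at \<open>1\<close> with the one at \<open>1 + 1 / ln w\<close>, which is at least the inverse
  of the zeta function there.\<close>
lemma euler_prod_ln_ge:
  assumes "w \<ge> 2"
  shows "1 \<le> 3 * exp 14 * (ln (real w) * euler_prod (primes_in 0 w))"
proof -
  define \<sigma> where "\<sigma> = 1 / ln (real w)"
  define P where "P = primes_in 0 w"
  have P: "prime p" if "p \<in> P" for p using that by (simp add: P_def primes_in_def)
  have lnw: "ln (real w) \<ge> 1/2"
    using ln2_ge_two_thirds ln_mono[of 2 "real w"] assms by linarith
  hence \<sigma>: "\<sigma> > 0" by (simp add: \<sigma>_def)
  have "(\<Prod>p\<in>P. 1 - real p powr - (1 + \<sigma>)) \<le> (\<Prod>p\<in>P. (1 - 1 / real p) * exp (\<sigma> * (ln (real p) / (real p - 1))))"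
    by (intro prod_mono conjI one_minus_powr_le one_minus_powr_nonneg P \<sigma>)
  also have "\<dots> = euler_prod P * exp (\<sigma> * log_sum P)"
    unfolding prod.distrib euler_prod_def log_sum_def sum_distrib_left
    by (subst exp_sum) (auto simp: P_def)
  also have "\<dots> \<le> euler_prod P * exp 14"
  proof (intro mult_left_mono)
    have "log_sum P \<le> 14 * ln (real w)" unfolding P_def by (rule log_sum_le[OF assms])
    hence "\<sigma> * log_sum P \<le> \<sigma> * (14 * ln (real w))" using \<sigma> by (intro mult_left_mono) auto
    also have "\<dots> = 14" using lnw by (simp add: \<sigma>_def)
    finally show "exp (\<sigma> * log_sum P) \<le> exp 14" by simp
  qed (simp add: P_def less_imp_le)
  finally have le: "(\<Prod>p\<in>P. 1 - real p powr - (1 + \<sigma>)) \<le> euler_prod P * exp 14" .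
  have "1 \<le> (1 + 1 / \<sigma>) * (\<Prod>p\<in>P. 1 - real p powr - (1 + \<sigma>))"
    by (rule prod_one_minus_powr_ge) (use P \<sigma> in \<open>auto simp: P_def\<close>)
  also have "\<dots> \<le> (3 * ln (real w)) * (euler_prod P * exp 14)"
  proof (intro mult_mono le)
    \<comment> \<open>Here \<open>1 / \<sigma> = ln w\<close> and \<open>ln w \<ge> 1 / 2\<close>;
      this is the origin of the factor 3.\<close>
    show "1 + 1 / \<sigma> \<le> 3 * ln (real w)" using lnw by (simp add: \<sigma>_def)
    show "0 \<le> (\<Prod>p\<in>P. 1 - real p powr - (1 + \<sigma>))"
      by (intro prod_nonneg one_minus_powr_nonneg P \<sigma>)
  qed (use lnw in auto)
  finally show ?thesis by (simp add: P_def mult_ac)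
qed

section \<open>An upper bound sieve\<close>

definition rough_upto :: "nat \<Rightarrow> nat \<Rightarrow> nat set" where
  "rough_upto w Y = {t. 1 \<le> t \<and> t \<le> Y \<and> (\<forall>p. prime p \<longrightarrow> p dvd t \<longrightarrow> w < p)}"

lemma finite_rough_upto [simp, intro]: "finite (rough_upto w Y)"
  by (rule finite_subset[of _ "{..Y}"]) (auto simp: rough_upto_def)

lemma rough_upto_dvd: "t \<in> rough_upto w Y \<Longrightarrow> d dvd t \<Longrightarrow> d \<in> rough_upto w Y"
  by (auto simp: rough_upto_def dest: dvd_imp_le dvd_trans intro: Suc_leI dvd_pos_nat)

text \<open>Write \<open>ln t\<close> as a divisor sum and \<open>t = d * n\<close>. The cofactor
  \<open>n\<close> is again rough; forgetting that \<open>d\<close> is rough leaves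
  \<open>psi (Y div n)\<close>, and Chebyshev's bound applies.\<close>

lemma sum_ln_rough_le:
  "(\<Sum>t\<in>rough_upto w Y. ln (real t)) \<le> 4 * real Y * (\<Sum>t\<in>rough_upto w Y. 1 / real t)"
proof -
  define F where "F = rough_upto w Y"
  have pos: "t > 0" if "t \<in> F" for t using that by (auto simp: F_def rough_upto_def)
  have le: "t \<le> Y" if "t \<in> F" for t using that by (auto simp: F_def rough_upto_def)
  have "(\<Sum>t\<in>F. ln (real t)) = (\<Sum>t\<in>F. \<Sum>d | d dvd t. mangoldt d)"
    using mangoldt_sum[where ?'a = real] pos by (intro sum.cong) auto
  also have "\<dots> = (\<Sum>(t,d)\<in>Sigma F (\<lambda>t. {d. d dvd t}). mangoldt d)"
    using pos by (subst sum.Sigma) (auto simp: F_def intro!: finite_divisors_nat)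
  also have "\<dots> = (\<Sum>(n,d)\<in>(\<lambda>(t,d). (t div d, d)) ` Sigma F (\<lambda>t. {d. d dvd t}). mangoldt d)"
  proof (subst sum.reindex)
    show "inj_on (\<lambda>(t,d). (t div d, d)) (Sigma F (\<lambda>t. {d. d dvd t}))"
      by (auto simp: inj_on_def dvd_div_eq_iff dest: pos)
  qed (simp add: case_prod_unfold o_def)
  also have "\<dots> \<le> (\<Sum>(n,d)\<in>Sigma F (\<lambda>n. {1..Y div n}). mangoldt d)"
  proof (intro sum_mono2)
    show "(\<lambda>(t,d). (t div d, d)) ` Sigma F (\<lambda>t. {d. d dvd t}) \<subseteq> Sigma F (\<lambda>n. {1..Y div n})"
    proof clarify
      fix t d assume td: "t \<in> F" "d dvd t"
      then obtain n where n: "t = d * n" by auto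
      hence "d > 0" "n > 0" using pos[OF td(1)] by auto
      moreover have "n \<in> F" using td n rough_upto_dvd unfolding F_def by (metis dvd_triv_right)
      moreover have "d * n \<le> Y" using le[OF td(1)] n by simp
      ultimately show "t div d \<in> F \<and> d \<in> {1..Y div (t div d)}"
        using n by (simp add: less_eq_div_iff_mult_less_eq)
    qed
  qed (auto simp: F_def mangoldt_nonneg)
  also have "\<dots> = (\<Sum>n\<in>F. psi (Y div n))"
    unfolding psi_def by (subst sum.Sigma) (auto simp: F_def)
  also have "\<dots> \<le> (\<Sum>n\<in>F. 4 * real Y * (1 / real n))"
  proof (intro sum_mono)
    fix n assume "n \<in> F"
    have "psi (Y div n) \<le> 4 * real (Y div n)" by (rule psi_le)
    also have "real (Y div n) \<le> real Y / real n" by (rule of_nat_div_le_of_nat)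
    finally show "psi (Y div n) \<le> 4 * real Y * (1 / real n)" by simp
  qed
  finally show ?thesis by (simp add: F_def sum_distrib_left)
qed

text \<open>The argument of Hall and Tenenbaum: sum \<open>ln Y = ln t + ln (Y / t)\<close> over the rough \<open>t\<close>.\<close>
lemma card_rough_upto_le:
  assumes "w \<le> Y" "Y \<ge> 2"
  shows "real (card (rough_upto w Y)) \<le> 15 * exp 14 * real Y * euler_prod (primes_in 0 w)"
proof -
  define F where "F = rough_upto w Y"
  have lnY: "ln (real Y) > 0" using assms by simp
  have mem: "t > 0" "t \<le> Y" "prime_factors t \<subseteq> primes_in w Y" if "t \<in> F" for t
    using that prime_factors_subset_primes_in[of t Y w] by (auto simp: F_def rough_upto_def)
  have "real (card F) * ln (real Y) = (\<Sum>t\<in>F. ln (real t)) + (\<Sum>t\<in>F. ln (real Y / real t))"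
    using mem(1) assms by (simp add: ln_div sum_subtractf)
  also have "(\<Sum>t\<in>F. ln (real Y / real t)) \<le> (\<Sum>t\<in>F. real Y * (1 / real t))"
  proof (intro sum_mono)
    fix t assume "t \<in> F"
    thus "ln (real Y / real t) \<le> real Y * (1 / real t)"
      using ln_le_minus_one[of "real Y / real t"] mem(1)[of t] assms by simp
  qed
  also have "(\<Sum>t\<in>F. ln (real t)) + (\<Sum>t\<in>F. real Y * (1 / real t)) \<le> 5 * real Y * (\<Sum>t\<in>F. 1 / real t)"
    using sum_ln_rough_le[of w Y] unfolding F_def sum_distrib_left[symmetric] by simp
  also have "\<dots> \<le> 5 * real Y * (1 / euler_prod (primes_in w Y))"
    using mem by (intro mult_left_mono sum_inverse_le_euler_prod) (auto simp: F_def)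
  \<comment> \<open>The product over \<open>(w, Y]\<close> is a quotient of two full products; the
    lower bound for the one up to \<open>Y\<close> yields a factor \<open>ln Y\<close>, which
    cancels against the left-hand side.\<close>
  also have "1 / euler_prod (primes_in w Y) \<le> 3 * exp 14 * ln (real Y) * euler_prod (primes_in 0 w)"
    using euler_prod_ln_ge[OF assms(2)] euler_prod_primes_split[of 0 w Y] assms(1)
      euler_prod_primes_pos[of w Y] by (simp add: field_simps)
  finally have "real (card F) * ln (real Y) \<le> (15 * exp 14 * real Y * euler_prod (primes_in 0 w)) * ln (real Y)"
    using assms by (simp add: mult_left_mono algebra_simps)
  thus ?thesis using lnY by (simp add: F_def)
qed

section \<open>Smooth parts\<close>

text \<open>The largest divisor of \<open>m\<close> composed of primes from \<open>P\<close>.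
  Arbitrary \<open>P\<close> covers smooth parts, rough cofactors and ranges in between; at
  \<open>m = 0\<close> the empty product gives 1.\<close>

definition part :: "nat set \<Rightarrow> nat \<Rightarrow> nat" where
  "part P m = (\<Prod>p\<in>prime_factors m \<inter> P. p ^ multiplicity p m)"

lemma part_pos [simp]: "part P m > 0"
  unfolding part_def by (intro prod_pos) (auto dest: in_prime_factors_imp_prime prime_gt_0_nat)

lemma part_mult_disjoint: "P \<inter> Q = {} \<Longrightarrow> part P m * part Q m = part (P \<union> Q) m"
  unfolding part_def by (subst prod.union_disjoint[symmetric]) (auto simp: Int_Un_distrib)

lemma part_UNIV: "m > 0 \<Longrightarrow> part UNIV m = m"
  unfolding part_def using prod_prime_factors[of m] by simp

lemma part_mult_compl: "m > 0 \<Longrightarrow> part P m * part (-P) m = m"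
  by (simp add: part_mult_disjoint part_UNIV)

lemma part_dvd: "m > 0 \<Longrightarrow> part P m dvd m"
  by (metis part_mult_compl dvd_triv_left)

lemma part_le: "m > 0 \<Longrightarrow> part P m \<le> m"
  by (simp add: part_dvd dvd_imp_le)

lemma multiplicity_part:
  assumes "prime q" 
  shows "multiplicity q (part P m) = (if q \<in> P then multiplicity q m else 0)"
proof -
  have "multiplicity q (part P m) = (if q \<in> prime_factors m \<inter> P then multiplicity q m else 0)"
    unfolding part_def using assms by (intro multiplicity_prod_prime_powers) auto
  thus ?thesis using assms by (auto simp: prime_factors_multiplicity)
qed

lemma prime_factors_part: "prime_factors (part P m) = prime_factors m \<inter> P"
  by (auto simp: prime_factors_multiplicity multiplicity_part split: if_splits)

lemma part_part: "part P (part Q m) = part (P \<inter> Q) m"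
proof -
  have "part P (part Q m) = (\<Prod>p\<in>prime_factors m \<inter> Q \<inter> P. p ^ multiplicity p m)"
    unfolding part_def[of P] prime_factors_part
    by (intro prod.cong) (auto simp: multiplicity_part in_prime_factors_imp_prime)
  thus ?thesis by (simp add: part_def Int_ac)
qed

abbreviation smooth_part :: "nat \<Rightarrow> nat \<Rightarrow> nat" where
  "smooth_part w \<equiv> part {..w}"

lemma prime_factors_smooth_part: "prime_factors (smooth_part w m) \<subseteq> primes_in 0 w"
  by (auto simp: prime_factors_part primes_in_def prime_factors_gt_0_nat)

lemma smooth_part_id: "m > 0 \<Longrightarrow> prime_factors m \<subseteq> primes_in 0 w \<Longrightarrow> smooth_part w m = m"
  using part_UNIV[of m] unfolding part_def
  by (metis (no_types, lifting) Int_absorb2 Int_UNIV_right atMost_iff mem_Collect_eq primes_in_def subset_iff)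

lemma part_compl_rough:
  assumes "m > 0" "m \<le> X"
  shows "part (- {..w}) m \<in> rough_upto w (X div smooth_part w m)"
proof -
  have "part (- {..w}) m * smooth_part w m \<le> X" 
    using part_mult_compl[of m "{..w}"] assms by (simp add: mult.commute)
  hence "part (- {..w}) m \<le> X div smooth_part w m"
    by (simp add: less_eq_div_iff_mult_less_eq)
  moreover have "w < p" if "prime p" "p dvd part (- {..w}) m" for p
    using prime_factors_part[of "- {..w}" m] that part_pos[of "- {..w}" m]
    by (auto simp: prime_factors_dvd)
  ultimately show ?thesis using part_pos[of "- {..w}" m] by (simp add: rough_upto_def Suc_le_eq)
qed

section \<open>Counting integers by their smooth parts\<close>

text \<open>Transfers counting up to \<open>X\<close> to the measure \<open>1 / s\<close>:
  \<open>m\<close> is determined by its smooth part \<open>s\<close> and a rough cofactor up to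
  \<open>X div s\<close>, and \<open>s * w \<le> X\<close> leaves enough room for the sieve
  bound.\<close>

lemma card_smooth_part_in_le:
  assumes "w \<ge> 2" "finite D" "\<And>s. s \<in> D \<Longrightarrow> s > 0 \<and> s * w \<le> X"
  shows "real (card {m\<in>{1..X}. smooth_part w m \<in> D})
    \<le> 15 * exp 14 * real X * (euler_prod (primes_in 0 w) * (\<Sum>s\<in>D. 1 / real s))"
proof -
  let ?M = "{m\<in>{1..X}. smooth_part w m \<in> D}"
  let ?S = "Sigma D (\<lambda>s. rough_upto w (X div s))"
  let ?f = "\<lambda>m. (smooth_part w m, part (- {..w}) m)"
  have "inj_on ?f ?M"
  proof (rule inj_onI)
    fix m m' assume "m \<in> ?M" "m' \<in> ?M" "?f m = ?f m'"
    thus "m = m'" using part_mult_compl[of m "{..w}"] part_mult_compl[of m' "{..w}"] by simp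
  qed
  moreover have "?f ` ?M \<subseteq> ?S" using part_compl_rough by auto
  ultimately have "card ?M \<le> card ?S" using assms(2) by (intro card_inj_on_le) auto
  also have "\<dots> = (\<Sum>s\<in>D. card (rough_upto w (X div s)))" using assms(2) by simp
  finally have "real (card ?M) \<le> (\<Sum>s\<in>D. real (card (rough_upto w (X div s))))"
    by (simp flip: of_nat_sum)
  also have "\<dots> \<le> (\<Sum>s\<in>D. 15 * exp 14 * real X * euler_prod (primes_in 0 w) * (1 / real s))"
  proof (intro sum_mono)
    fix s assume "s \<in> D"
    hence s: "s > 0" "s * w \<le> X" using assms(3) by auto
    hence "w \<le> X div s" by (simp add: less_eq_div_iff_mult_less_eq mult.commute)
    hence "real (card (rough_upto w (X div s))) \<le> 15 * exp 14 * real (X div s) * euler_prod (primes_in 0 w)"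
      using assms(1) by (intro card_rough_upto_le) auto
    also have "\<dots> \<le> 15 * exp 14 * (real X / real s) * euler_prod (primes_in 0 w)"
      by (intro mult_right_mono mult_left_mono of_nat_div_le_of_nat) (auto simp: less_imp_le)
    finally show "real (card (rough_upto w (X div s))) 
        \<le> 15 * exp 14 * real X * euler_prod (primes_in 0 w) * (1 / real s)" by simp
  qed
  also have "\<dots> = 15 * exp 14 * real X * (euler_prod (primes_in 0 w) * (\<Sum>s\<in>D. 1 / real s))"
    unfolding sum_distrib_left by (simp add: mult_ac)
  finally show ?thesis .
qed

text \<open>Only multiples \<open>p * j\<close> contribute, each 1 more than \<open>j\<close> does,
  which reduces \<open>n\<close> to \<open>n div p\<close>.\<close>

lemma sum_multiplicity_le:
  assumes "prime (p::nat)"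
  shows "(\<Sum>m=1..n. real (multiplicity p m)) \<le> real n / (real p - 1)"
proof (induction n rule: less_induct)
  case (less n)
  have p: "p > 1" using assms by (rule prime_gt_1_nat)
  define k where "k = n div p"
  show ?case
  proof (cases "n = 0")
    case False
    hence "k < n" using p by (simp add: k_def)
    have "(\<Sum>m=1..n. real (multiplicity p m)) = (\<Sum>m\<in>{m\<in>{1..n}. p dvd m}. real (multiplicity p m))"
      by (intro sum.mono_neutral_right) (auto simp: not_dvd_imp_multiplicity_0)
    also have "\<dots> = (\<Sum>j=1..k. real (multiplicity p (p * j)))"
      using p by (intro sum.reindex_bij_witness[of _ "\<lambda>j. p * j" "\<lambda>m. m div p"])
        (auto simp: less_eq_div_iff_mult_less_eq mult.commute Suc_le_eq k_def elim!: dvdE)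
    also have "\<dots> = (\<Sum>j=1..k. 1 + real (multiplicity p j))"
      using p by (intro sum.cong) (auto simp: multiplicity_times_same)
    also have "\<dots> \<le> real k + real k / (real p - 1)"
      using less.IH[OF \<open>k < n\<close>] by (simp add: sum.distrib)
    also have "\<dots> = real k * (real p / (real p - 1))" using p by (simp add: field_simps)
    also have "\<dots> \<le> (real n / real p) * (real p / (real p - 1))"
      unfolding k_def using p by (intro mult_right_mono of_nat_div_le_of_nat) auto
    also have "\<dots> = real n / (real p - 1)" using p by simp
    finally show ?thesis .
  qed simp
qed

lemma ln_smooth_part:
  assumes "m > 0"
  shows "ln (real (smooth_part w m)) = (\<Sum>p\<in>primes_in 0 w. real (multiplicity p m) * ln (real p))"
proof -
  have "ln (real (smooth_part w m)) = (\<Sum>p\<in>prime_factors m \<inter> {..w}. ln (real (p ^ multiplicity p m)))"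
    unfolding part_def of_nat_prod
    by (subst ln_prod) (auto intro: prime_factors_gt_0_nat)
  also have "\<dots> = (\<Sum>p\<in>prime_factors m \<inter> {..w}. real (multiplicity p m) * ln (real p))"
    by (intro sum.cong) (auto simp: ln_realpow intro: prime_factors_gt_0_nat)
  also have "\<dots> = (\<Sum>p\<in>primes_in 0 w. real (multiplicity p m) * ln (real p))"
    by (intro sum.mono_neutral_left) 
       (auto simp: primes_in_def prime_factors_multiplicity intro: prime_gt_0_nat)
  finally show ?thesis .
qed

text \<open>Markov's inequality for \<open>ln (smooth_part w m)\<close>, whose sum over
  \<open>m \<le> X\<close> is at most \<open>X * log_sum\<close>; squaring avoids a square root of
  \<open>X\<close>.\<close>

lemma card_large_smooth_part_le:
  assumes "w \<ge> 2" "X \<ge> 2"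
  shows "real (card {m\<in>{1..X}. (smooth_part w m)\<^sup>2 > X}) * ln (real X) \<le> 28 * ln (real w) * real X"
proof -
  let ?M = "{m\<in>{1..X}. (smooth_part w m)\<^sup>2 > X}"
  have "real (card ?M) * ln (real X) = (\<Sum>m\<in>?M. ln (real X))" by simp
  also have "\<dots> \<le> (\<Sum>m\<in>?M. 2 * ln (real (smooth_part w m)))"
  proof (intro sum_mono)
    fix m assume "m \<in> ?M"
    hence "real X \<le> real (smooth_part w m) ^ 2" by (simp flip: of_nat_power)
    hence "ln (real X) \<le> ln (real (smooth_part w m) ^ 2)" using assms by (intro ln_mono) auto
    thus "ln (real X) \<le> 2 * ln (real (smooth_part w m))" by (simp add: ln_realpow)
  qed
  also have "\<dots> \<le> (\<Sum>m=1..X. 2 * ln (real (smooth_part w m)))"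
    by (intro sum_mono2) (auto intro!: ln_ge_zero simp: Suc_le_eq)
  also have "\<dots> = (\<Sum>m=1..X. 2 * (\<Sum>p\<in>primes_in 0 w. real (multiplicity p m) * ln (real p)))"
    by (intro sum.cong) (auto simp: ln_smooth_part)
  also have "\<dots> = 2 * (\<Sum>p\<in>primes_in 0 w. (\<Sum>m=1..X. real (multiplicity p m)) * ln (real p))"
    unfolding sum_distrib_left[symmetric] sum_distrib_right by (subst sum.swap) simp
  also have "\<dots> \<le> 2 * (\<Sum>p\<in>primes_in 0 w. (real X / (real p - 1)) * ln (real p))"
  proof (intro mult_left_mono sum_mono mult_right_mono sum_multiplicity_le)
    fix p assume "p \<in> primes_in 0 w"
    thus "prime p" "ln (real p) \<ge> 0" by (auto simp: primes_in_def)
  qed auto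
  also have "\<dots> = 2 * real X * log_sum (primes_in 0 w)"
    by (simp add: log_sum_def sum_distrib_left mult_ac)
  also have "\<dots> \<le> 2 * real X * (14 * ln (real w))"
    by (intro mult_left_mono log_sum_le assms) auto
  finally show ?thesis by (simp add: mult_ac)
qed

text \<open>The sieve bound with all smooth parts up to \<open>v\<close>: the harmonic sum gives
  \<open>1 + ln v\<close> and the Euler product at most \<open>1 / ln w\<close>.\<close>

lemma card_small_smooth_part_le:
  assumes "w \<ge> 2" "v \<ge> 1" "v * w \<le> X"
  shows "real (card {m\<in>{1..X}. smooth_part w m \<le> v}) * ln (real w)
    \<le> 15 * exp 14 * real X * (1 + ln (real v))"
proof -
  have "{m\<in>{1..X}. smooth_part w m \<le> v} = {m\<in>{1..X}. smooth_part w m \<in> {1..v}}"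
    by (auto simp: Suc_le_eq)
  hence "real (card {m\<in>{1..X}. smooth_part w m \<le> v})
    \<le> 15 * exp 14 * real X * (euler_prod (primes_in 0 w) * (\<Sum>s=1..v. 1 / real s))"
    using card_smooth_part_in_le[OF assms(1), of "{1..v}" X] assms(3)
    by (auto intro: order.trans[OF mult_right_mono])
  also have "(\<Sum>s=1..v. 1 / real s) \<le> 1 + ln (real v)"
  proof -
    \<comment> \<open>The harmonic number minus the logarithm decreases from its value 1 at
      \<open>v = 1\<close>.\<close>
    obtain n where "v = Suc n" using assms(2) by (cases v) auto
    thus ?thesis using decseqD[OF decseq_harm_diff_ln, of 0 n] by (simp add: harm_def inverse_eq_divide)
  qed
  finally have "real (card {m\<in>{1..X}. smooth_part w m \<le> v}) * ln (real w)
    \<le> 15 * exp 14 * real X * (euler_prod (primes_in 0 w) * (1 + ln (real v))) * ln (real w)"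
    using assms by (simp add: mult_left_mono mult_right_mono less_imp_le)
  also have "\<dots> = (15 * exp 14 * real X * (1 + ln (real v))) * (ln (real w) * euler_prod (primes_in 0 w))"
    by simp
  also have "\<dots> \<le> (15 * exp 14 * real X * (1 + ln (real v))) * 1"
    using assms by (intro mult_left_mono ln_euler_prod_le) auto
  finally show ?thesis by simp
qed

text \<open>A union bound over \<open>d\<close>, summed by telescoping with
  \<open>1 / d^2 \<le> 1 / (d - 1) - 1 / d\<close>. Since \<open>d \<le> d^2 \<le> m\<close>, only
  \<open>d \<le> D + X\<close> can occur.\<close>

lemma card_square_multiples_le:
  assumes "D \<ge> 1"
  shows "real (card {m\<in>{1..X}. \<exists>d>D. d\<^sup>2 dvd m}) \<le> real X / real D"
proof -
  have "{m\<in>{1..X}. \<exists>d>D. d\<^sup>2 dvd m} \<subseteq> (\<Union>d\<in>{D<..D+X}. {m\<in>{1..X}. d\<^sup>2 dvd m})"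
  proof clarify
    fix m d assume m: "m \<in> {1..X}" "D < d" "d\<^sup>2 dvd m"
    have "d \<le> d\<^sup>2" by (simp add: power2_eq_square)
    also have "d\<^sup>2 \<le> m" using m by (auto intro: dvd_imp_le)
    finally show "m \<in> (\<Union>d\<in>{D<..D+X}. {m\<in>{1..X}. d\<^sup>2 dvd m})" using m by auto
  qed
  hence "card {m\<in>{1..X}. \<exists>d>D. d\<^sup>2 dvd m} \<le> card (\<Union>d\<in>{D<..D+X}. {m\<in>{1..X}. d\<^sup>2 dvd m})"
    by (intro card_mono) auto
  also have "\<dots> \<le> (\<Sum>d\<in>{D<..D+X}. card {m\<in>{1..X}. d\<^sup>2 dvd m})"
    by (intro card_UN_le) auto
  finally have "real (card {m\<in>{1..X}. \<exists>d>D. d\<^sup>2 dvd m}) \<le> (\<Sum>d\<in>{D<..D+X}. real (card {m\<in>{1..X}. d\<^sup>2 dvd m}))"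
    by (simp flip: of_nat_sum)
  also have "\<dots> \<le> (\<Sum>d\<in>{D<..D+X}. real X * (1 / real (d - 1) - 1 / real d))"
  proof (intro sum_mono)
    fix d assume "d \<in> {D<..D+X}"
    hence d: "d \<ge> 2" using assms by auto
    have "real (card {m\<in>{1..X}. d\<^sup>2 dvd m}) = real (X div d\<^sup>2)" using card_multiples[of "d\<^sup>2" X] d by simp
    also have "\<dots> \<le> real X / real (d\<^sup>2)" by (rule of_nat_div_le_of_nat)
    also have "\<dots> = real X * (1 / (real d * real d))" by (simp add: power2_eq_square)
    also have "\<dots> \<le> real X * (1 / real (d - 1) - 1 / real d)"
      using d by (intro mult_left_mono) (auto simp: field_simps of_nat_diff)
    finally show "real (card {m\<in>{1..X}. d\<^sup>2 dvd m}) \<le> real X * (1 / real (d - 1) - 1 / real d)" .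
  qed
  also have "\<dots> = real X * (\<Sum>d\<in>{D<..D+X}. 1 / real (d - 1) - 1 / real d)" by (simp add: sum_distrib_left)
  also have "(\<Sum>d\<in>{D<..D+X}. 1 / real (d - 1) - 1 / real d) = 1 / real D - 1 / real (D + X)"
  proof (induction X)
    case (Suc X)
    have "{D<..D + Suc X} = insert (D + Suc X) {D<..D+X}" by auto
    thus ?case using Suc by simp
  qed simp
  also have "real X * (1 / real D - 1 / real (D + X)) \<le> real X * (1 / real D)"
    by (intro mult_left_mono) auto
  finally show ?thesis by simp
qed

section \<open>Smooth parts at many scales\<close>

text \<open>\<open>mass\<close> is the probability of \<open>B\<close> when a \<open>w\<close>-smooth number \<open>s\<close> is drawn with probability proportional
  to \<open>1 / s\<close>, and \<open>log_mass\<close> is the expectation of \<open>ln s / ln w\<close> restricted to \<open>B\<close>.\<close>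
definition mass :: "nat \<Rightarrow> nat set \<Rightarrow> real" where
  "mass w B = euler_prod (primes_in 0 w) * (\<Sum>s\<in>B. 1 / real s)"

definition log_mass :: "nat \<Rightarrow> nat set \<Rightarrow> real" where
  "log_mass w B = euler_prod (primes_in 0 w) * (\<Sum>s\<in>B. ln (real s) / real s) / ln (real w)"

text \<open>Each \<open>s\<close> factors uniquely into its \<open>w\<close>-smooth part and a
  cofactor with primes in \<open>(w, w']\<close>. The constraint \<open>s * n \<in> B'\<close> is
  retained because \<open>mass_step\<close> uses it to exclude the cofactor 1.\<close>

lemma sum_part_split_le:
  fixes h :: "nat \<Rightarrow> real"
  assumes "finite B" "finite B'" "w \<le> w'"
    and B: "\<And>s. s \<in> B' \<Longrightarrow> s > 0 \<and> prime_factors s \<subseteq> primes_in 0 w' \<and> smooth_part w s \<in> B"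
    and h: "\<And>s. h s \<ge> 0"
  shows "\<exists>M. finite M \<and> (\<forall>n\<in>M. n > 0 \<and> prime_factors n \<subseteq> primes_in w w') \<and>
    (\<Sum>s\<in>B'. h s) \<le> (\<Sum>s\<in>B. \<Sum>n | n \<in> M \<and> s * n \<in> B'. h (s * n))"
proof (intro exI conjI ballI)
  define M where "M = part {w<..} ` B'"
  show fin: "finite M" using assms by (simp add: M_def)
  fix n assume "n \<in> M"
  then obtain s where s: "n = part {w<..} s" "s \<in> B'" unfolding M_def by (rule imageE)
  show "n > 0" by (simp add: s)
  show "prime_factors n \<subseteq> primes_in w w'"
    using B[OF s(2)] by (auto simp: s prime_factors_part primes_in_def)
next
  define M where "M = part {w<..} ` B'"
  have fin: "finite M" using assms by (simp add: M_def)
  have eq: "smooth_part w s * part {w<..} s = s" if "s \<in> B'" for s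
  proof -
    have "- {..w} = {w<..}" by auto
    thus ?thesis using part_mult_compl[of s "{..w}"] B[OF that] by simp
  qed
  let ?f = "\<lambda>s. (smooth_part w s, part {w<..} s)"
  have "(\<Sum>s\<in>B'. h s) = (\<Sum>(s,n)\<in>?f ` B'. h (s * n))"
  proof (subst sum.reindex)
    show "inj_on ?f B'" by (rule inj_onI) (metis eq prod.inject)
  qed (simp add: eq)
  also have "\<dots> \<le> (\<Sum>(s,n)\<in>Sigma B (\<lambda>s. {n. n \<in> M \<and> s * n \<in> B'}). h (s * n))"
    using assms fin eq B h by (intro sum_mono2) (auto simp: M_def)
  also have "\<dots> = (\<Sum>s\<in>B. \<Sum>n | n \<in> M \<and> s * n \<in> B'. h (s * n))"
    using assms fin by (subst sum.Sigma) auto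
  finally show "(\<Sum>s\<in>B'. h s) \<le> (\<Sum>s\<in>B. \<Sum>n | n \<in> M \<and> s * n \<in> B'. h (s * n))" .
qed

text \<open>\<open>ln (s * n) = ln s + ln n\<close>, where the cofactor contributes on average at
  most \<open>14 * L * ln w\<close>; normalising by \<open>L * ln w\<close> shrinks the old part by
  \<open>L\<close>.\<close>

lemma log_mass_step:
  assumes "finite B" "finite B'" "w \<ge> 2" "L \<ge> 2"
    and Bpos: "\<And>s. s \<in> B \<Longrightarrow> s > 0"
    and B: "\<And>s. s \<in> B' \<Longrightarrow> s > 0 \<and> prime_factors s \<subseteq> primes_in 0 (w ^ L) \<and> smooth_part w s \<in> B"
  shows "log_mass (w ^ L) B' \<le> log_mass w B / real L + 14 * mass w B"
proof -
  have ww: "w \<le> w ^ L" using assms self_le_power[of w L] by simp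
  define R where "R = euler_prod (primes_in w (w ^ L))"
  have R: "R > 0" by (simp add: R_def)
  have eul: "euler_prod (primes_in 0 (w ^ L)) = euler_prod (primes_in 0 w) * R"
    unfolding R_def using ww by (intro euler_prod_primes_split) auto
  have lnw: "ln (real w) > 0" using assms by simp
  define h where "h s = (if s = 0 then 0 else ln (real s) / real s)" for s
  have h0: "h s \<ge> 0" for s by (auto simp: h_def intro!: divide_nonneg_nonneg ln_ge_zero)
  obtain M where M': "finite M \<and> (\<forall>n\<in>M. n > 0 \<and> prime_factors n \<subseteq> primes_in w (w ^ L)) \<and>
      (\<Sum>s\<in>B'. h s) \<le> (\<Sum>s\<in>B. \<Sum>n | n \<in> M \<and> s * n \<in> B'. h (s * n))"
    using sum_part_split_le[of B B' w "w ^ L" h, OF assms(1,2) ww B h0] ..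
  hence M: "finite M" "\<And>n. n \<in> M \<Longrightarrow> n > 0 \<and> prime_factors n \<subseteq> primes_in w (w ^ L)" by auto
  have pr: "prime p" if "p \<in> primes_in w (w ^ L)" for p using that by (simp add: primes_in_def)
  have "(\<Sum>s\<in>B'. ln (real s) / real s) = (\<Sum>s\<in>B'. h s)"
    using B by (intro sum.cong) (auto simp: h_def)
  also note M'[THEN conjunct2, THEN conjunct2]
  also have "(\<Sum>s\<in>B. \<Sum>n | n \<in> M \<and> s * n \<in> B'. h (s * n)) 
      \<le> (\<Sum>s\<in>B. 1 / real s * ((ln (real s) + 14 * (real L * ln (real w))) / R))"
  proof (intro sum_mono)
    fix s assume "s \<in> B"
    hence s: "s > 0" using Bpos by auto
    have "(\<Sum>n | n \<in> M \<and> s * n \<in> B'. h (s * n)) = 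
        1 / real s * (\<Sum>n | n \<in> M \<and> s * n \<in> B'. (ln (real s) + 1 * ln (real n)) / real n)"
      unfolding sum_distrib_left
    proof (intro sum.cong refl)
      fix n assume "n \<in> {n \<in> M. s * n \<in> B'}"
      hence "n > 0" using M(2) by auto
      thus "h (s * n) = 1 / real s * ((ln (real s) + 1 * ln (real n)) / real n)"
        using s by (simp add: h_def ln_mult)
    qed
    also have "\<dots> \<le> 1 / real s * ((ln (real s) + 1 * log_sum (primes_in w (w ^ L))) / R)"
      unfolding R_def using s M
      by (intro mult_left_mono sum_over_P_numbers_le pr) auto
    also have "log_sum (primes_in w (w ^ L)) \<le> 14 * (real L * ln (real w))"
      using log_sum_le[of "w ^ L" w] assms ww by (simp add: ln_realpow)
    finally show "(\<Sum>n | n \<in> M \<and> s * n \<in> B'. h (s * n)) 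
      \<le> 1 / real s * ((ln (real s) + 14 * (real L * ln (real w))) / R)"
      using R by (simp add: divide_right_mono mult_left_mono)
  qed
  also have "\<dots> = ((\<Sum>s\<in>B. ln (real s) / real s) + 14 * (real L * ln (real w)) * (\<Sum>s\<in>B. 1 / real s)) / R"
    by (simp add: sum_distrib_left sum_divide_distrib add_divide_distrib distrib_left sum.distrib mult_ac)
  finally have le: "(\<Sum>s\<in>B'. ln (real s) / real s) \<le> \<dots>" .
  define e where "e = euler_prod (primes_in 0 w)"
  have e: "e > 0" by (simp add: e_def)
  have "log_mass (w ^ L) B' = e * R / (real L * ln (real w)) * (\<Sum>s\<in>B'. ln (real s) / real s)"
    using assms by (simp add: log_mass_def eul ln_realpow e_def)
  also have "\<dots> \<le> e * R / (real L * ln (real w)) * 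
     (((\<Sum>s\<in>B. ln (real s) / real s) + 14 * (real L * ln (real w)) * (\<Sum>s\<in>B. 1 / real s)) / R)"
    using e R lnw by (intro mult_left_mono le) auto
  also have "\<dots> = log_mass w B / real L + 14 * mass w B"
    using e R lnw assms unfolding log_mass_def mass_def e_def[symmetric] by (simp add: field_simps)
  finally show ?thesis .
qed

text \<open>The cofactor 1 has probability at least \<open>\<kappa>\<close> and is lost whenever
  \<open>s \<le> e * w ^ L\<close>. The indicator of this event is bounded below by a linear
  function of \<open>ln s\<close>, so the loss is expressed by \<open>mass\<close> and
  \<open>log_mass\<close> alone.\<close>

lemma mass_step:
  assumes "finite B" "finite B'" "w \<ge> 2" "L \<ge> 2" "e * real w \<ge> 1"
    and Bpos: "\<And>s. s \<in> B \<Longrightarrow> s > 0"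
    and B: "\<And>s. s \<in> B' \<Longrightarrow> s > 0 \<and> prime_factors s \<subseteq> primes_in 0 (w ^ L) \<and> smooth_part w s \<in> B"
    and large: "\<And>s. s \<in> B' \<Longrightarrow> real s > e * real (w ^ L)"
    and \<kappa>: "\<kappa> = 1 / (3 * exp 14 * real L)"
  shows "mass (w ^ L) B' \<le> (1 - \<kappa>) * mass w B + \<kappa> * log_mass w B / (real L - 1)"
proof -
  have ww: "w \<le> w ^ L" using assms self_le_power[of w L] by simp
  define R where "R = euler_prod (primes_in w (w ^ L))"
  have R: "R > 0" by (simp add: R_def)
  define \<rho> where "\<rho> = euler_prod (primes_in 0 w)"
  have \<rho>: "\<rho> > 0" by (simp add: \<rho>_def)
  have eul: "euler_prod (primes_in 0 (w ^ L)) = \<rho> * R"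
    unfolding R_def \<rho>_def using ww by (intro euler_prod_primes_split) auto
  have lnw: "ln (real w) > 0" using assms by simp
  have \<kappa>0: "\<kappa> > 0" using assms by simp
  \<comment> \<open>\<open>R\<close> is the quotient of the Euler products up to
    \<open>w ^ L\<close> and up to \<open>w\<close>; in the two Mertens bounds \<open>ln w\<close>
    cancels, leaving a bound that depends on \<open>L\<close> only.\<close>
  have \<kappa>R: "\<kappa> \<le> R"
  proof -
    have "1 \<le> 3 * exp 14 * (ln (real (w ^ L)) * euler_prod (primes_in 0 (w ^ L)))"
      using assms ww by (intro euler_prod_ln_ge) auto
    also have "\<dots> = 3 * exp 14 * real L * R * (ln (real w) * \<rho>)"
      using assms by (simp add: eul ln_realpow)
    also have "\<dots> \<le> 3 * exp 14 * real L * R * 1"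
      unfolding \<rho>_def using assms R by (intro mult_left_mono ln_euler_prod_le) auto
    finally show ?thesis using assms by (simp add: \<kappa> field_simps)
  qed
  define h where "h s = 1 / real s" for s
  have h0: "h s \<ge> 0" for s by (auto simp: h_def)
  obtain M where M': "finite M \<and> (\<forall>n\<in>M. n > 0 \<and> prime_factors n \<subseteq> primes_in w (w ^ L)) \<and>
      (\<Sum>s\<in>B'. h s) \<le> (\<Sum>s\<in>B. \<Sum>n | n \<in> M \<and> s * n \<in> B'. h (s * n))"
    using sum_part_split_le[of B B' w "w ^ L" h, OF assms(1,2) ww B h0] ..
  hence M: "finite M" "\<And>n. n \<in> M \<Longrightarrow> n > 0 \<and> prime_factors n \<subseteq> primes_in w (w ^ L)" by auto
  note M'[THEN conjunct2, THEN conjunct2]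
  also have "(\<Sum>s\<in>B. \<Sum>n | n \<in> M \<and> s * n \<in> B'. h (s * n)) 
      \<le> (\<Sum>s\<in>B. 1 / real s * ((1 - \<kappa> * (1 - ln (real s) / ((real L - 1) * ln (real w)))) / R))"
  proof (intro sum_mono)
    fix s assume "s \<in> B"
    hence s: "s > 0" using Bpos by auto
    define N where "N = {n \<in> M. s * n \<in> B'}"
    have N: "finite N" "\<And>n. n \<in> N \<Longrightarrow> n > 0 \<and> prime_factors n \<subseteq> primes_in w (w ^ L)"
      using M by (auto simp: N_def)
    define u where "u = 1 - ln (real s) / ((real L - 1) * ln (real w))"
    have "(\<Sum>n\<in>N. 1 / real n) \<le> (1 - \<kappa> * u) / R"
    \<comment> \<open>If \<open>s \<le> e * w ^ L\<close> then the cofactor \<open>1\<close> is excluded; otherwise \<open>u \<le> 0\<close>.\<close>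
    proof (cases "real s > e * real (w ^ L)")
      case True
      have "real w ^ (L - 1) \<le> (e * real w) * real w ^ (L - 1)"
        using assms mult_right_mono[of 1 "e * real w" "real w ^ (L - 1)"] by simp
      also have "\<dots> = e * real (w ^ L)" using assms by (cases L) auto
      finally have "real w ^ (L - 1) \<le> real s" using True by linarith
      hence "ln (real w ^ (L - 1)) \<le> ln (real s)" using assms by (intro ln_mono) auto
      hence "(real L - 1) * ln (real w) \<le> ln (real s)" using assms by (simp add: ln_realpow of_nat_diff)
      hence "u \<le> 0" using assms lnw by (simp add: u_def field_simps)
      hence "1 \<le> 1 - \<kappa> * u" using \<kappa>0 by (simp add: mult_le_0_iff)
      have "(\<Sum>n\<in>N. 1 / real n) \<le> 1 / R"
        unfolding R_def using N by (intro sum_inverse_le_euler_prod) auto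
      also have "\<dots> \<le> (1 - \<kappa> * u) / R" using \<open>1 \<le> 1 - \<kappa> * u\<close> R by (intro divide_right_mono) auto
      finally show ?thesis .
    next
      case False
      hence "1 \<notin> N" using large[of s] by (auto simp: N_def)
      hence "(\<Sum>n\<in>N. 1 / real n) + 1 = (\<Sum>n\<in>insert 1 N. 1 / real n)" using N by simp
      also have "\<dots> \<le> 1 / R"
        unfolding R_def using N by (intro sum_inverse_le_euler_prod) auto
      finally have "(\<Sum>n\<in>N. 1 / real n) \<le> 1 / R - 1" by simp
      also have "\<dots> \<le> 1 / R - \<kappa> / R" using \<kappa>R R by simp
      also have "\<dots> = (1 - \<kappa> * 1) / R" by (simp add: diff_divide_distrib)
      also have "\<dots> \<le> (1 - \<kappa> * u) / R"
      proof (intro divide_right_mono diff_left_mono mult_left_mono)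
        show "u \<le> 1" using s assms lnw by (simp add: u_def)
      qed (use \<kappa>0 R in auto)
      finally show ?thesis .
    qed
    hence "1 / real s * (\<Sum>n\<in>N. 1 / real n) \<le> 1 / real s * ((1 - \<kappa> * u) / R)"
      by (intro mult_left_mono) auto
    thus "(\<Sum>n | n \<in> M \<and> s * n \<in> B'. h (s * n)) 
       \<le> 1 / real s * ((1 - \<kappa> * (1 - ln (real s) / ((real L - 1) * ln (real w)))) / R)"
      by (simp add: N_def[symmetric] u_def h_def sum_distrib_left)
  qed
  also have "\<dots> = ((1 - \<kappa>) * (\<Sum>s\<in>B. 1 / real s) + \<kappa> / ((real L - 1) * ln (real w)) * (\<Sum>s\<in>B. ln (real s) / real s)) / R"
    unfolding sum_distrib_left sum_divide_distrib sum.distrib[symmetric]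
    by (intro sum.cong) (auto simp: diff_divide_distrib add_divide_distrib algebra_simps)
  finally have le: "(\<Sum>s\<in>B'. 1 / real s) \<le> \<dots>" by (simp add: h_def)
  have "mass (w ^ L) B' = \<rho> * R * (\<Sum>s\<in>B'. 1 / real s)" by (simp add: mass_def eul)
  also have "\<dots> \<le> \<rho> * R * (((1 - \<kappa>) * (\<Sum>s\<in>B. 1 / real s) + \<kappa> / ((real L - 1) * ln (real w)) * (\<Sum>s\<in>B. ln (real s) / real s)) / R)"
    using \<rho> R by (intro mult_left_mono le) auto
  also have "\<dots> = \<rho> * ((1 - \<kappa>) * (\<Sum>s\<in>B. 1 / real s) + \<kappa> / ((real L - 1) * ln (real w)) * (\<Sum>s\<in>B. ln (real s) / real s))"
    using R by simp
  also have "\<dots> = (1 - \<kappa>) * mass w B + \<kappa> * log_mass w B / (real L - 1)"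
    unfolding log_mass_def mass_def \<rho>_def[symmetric] by (simp add: distrib_left mult_ac)
  finally show ?thesis .
qed

lemma tower_mono:
  fixes w :: "nat \<Rightarrow> nat"
  assumes "\<And>i. w (Suc i) = w i ^ L" "i \<le> j" "L > 0"
  shows "w i \<le> w j"
proof (rule lift_Suc_mono_le[of w, OF _ assms(2)])
  fix n show "w n \<le> w (Suc n)" using assms by (cases "w n = 0") (auto intro: self_le_power)
qed

text \<open>The cutoff \<open>X\<close> ensures finiteness; the mass bound below is uniform in it.
  The condition at \<open>j = i\<close> concerns \<open>s\<close> itself.\<close>

definition bad_set :: "(nat \<Rightarrow> nat) \<Rightarrow> real \<Rightarrow> nat \<Rightarrow> nat \<Rightarrow> nat set" where
  "bad_set w e X i = {s\<in>{1..X}. prime_factors s \<subseteq> primes_in 0 (w i) \<and> 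
      (\<forall>j\<le>i. real (smooth_part (w j) s) > e * real (w j))}"

text \<open>The two step lemmas form a linear recursion for mass and log-mass; a suitable weighted
  sum \<open>V\<close> of the two contracts by \<open>1 - \<kappa> / 2\<close> at each scale. The
  value of \<open>\<kappa>\<close> is the one of \<open>mass_step\<close> for
  \<open>L = 60\<close>.\<close>

lemma mass_bad_set_le:
  fixes w :: "nat \<Rightarrow> nat"
  assumes w0: "w 0 \<ge> 2" and w_Suc: "\<And>i. w (Suc i) = w i ^ 60" and e: "e * real (w 0) \<ge> 1"
    and \<kappa>: "\<kappa> = 1 / (180 * exp 14)"
  shows "mass (w i) (bad_set w e X i) \<le> 2 * (1 - \<kappa> / 2) ^ i"
proof -
  define A where "A i = mass (w i) (bad_set w e X i)" for i
  define G where "G i = log_mass (w i) (bad_set w e X i)" for i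
  have "exp (14::real) \<ge> 1" by simp
  hence \<kappa>01: "0 < \<kappa>" "\<kappa> \<le> 1/180" by (auto simp: \<kappa> field_simps)
  have w2: "w i \<ge> w 0" for i by (rule tower_mono[of w 60]) (use w_Suc in auto)
  have e_pos: "e > 0" using e w0 by (metis less_le_trans mult_le_0_iff not_le of_nat_0_le_iff zero_less_one)
  have ew: "e * real (w i) \<ge> 1" for i
  proof -
    note e
    also have "e * real (w 0) \<le> e * real (w i)" using e_pos w2[of i] by (intro mult_left_mono) auto
    finally show ?thesis .
  qed
  have fin: "finite (bad_set w e X i)" for i by (simp add: bad_set_def)
  have pos: "s > 0" if "s \<in> bad_set w e X i" for s i using that by (simp add: bad_set_def)
  have mono: "w i \<le> w j" if "i \<le> j" for i j by (rule tower_mono[of w 60]) (use w_Suc that in auto)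
  have step: "s > 0 \<and> prime_factors s \<subseteq> primes_in 0 (w i ^ 60) \<and> smooth_part (w i) s \<in> bad_set w e X i"
    if s: "s \<in> bad_set w e X (Suc i)" for s i
  proof -
    have "smooth_part (w j) (smooth_part (w i) s) = smooth_part (w j) s" if "j \<le> i" for j
    proof -
      have "{..w j} \<inter> {..w i} = {..w j}" using mono[OF that] by auto
      thus ?thesis by (simp add: part_part)
    qed
    thus ?thesis using s part_le[of s "{..w i}"] prime_factors_smooth_part[of "w i" s]
      part_pos[of "{..w i}" s]
      by (auto simp: bad_set_def w_Suc Suc_le_eq)
  qed
  \<comment> \<open>A member is \<open>w (Suc i)\<close>-smooth, so its smooth part at the last
    scale is the number itself.\<close>
  have large: "real s > e * real (w i ^ 60)" if s: "s \<in> bad_set w e X (Suc i)" for s i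
  proof -
    have "smooth_part (w (Suc i)) s = s" using s by (intro smooth_part_id) (auto simp: bad_set_def)
    thus ?thesis using s unfolding bad_set_def w_Suc[symmetric] by auto
  qed
  have Gstep: "G (Suc i) \<le> G i / 60 + 14 * A i" for i
    unfolding G_def A_def w_Suc using log_mass_step[of "bad_set w e X i" "bad_set w e X (Suc i)" "w i" 60, OF fin fin _ _ pos step] w2[of i] w0
    by simp
  have Astep: "A (Suc i) \<le> (1 - \<kappa>) * A i + \<kappa> * G i / 59" for i
    unfolding G_def A_def w_Suc 
    using mass_step[where B = "bad_set w e X i" and B' = "bad_set w e X (Suc i)" and w = "w i" and L = 60
      and \<kappa> = \<kappa>, OF fin fin _ _ ew pos step large] w2[of i] w0
    by (simp add: \<kappa>)
  have G0: "G i \<ge> 0" for i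
    unfolding G_def log_mass_def
    using w2[of i] w0 pos
    by (intro divide_nonneg_nonneg mult_nonneg_nonneg sum_nonneg) (auto simp: less_imp_le Suc_le_eq)
  \<comment> \<open>The weight \<open>\<kappa> / 28\<close> makes \<open>14 * A i\<close> in Gstep cost only half of the gain \<open>\<kappa> * A i\<close> in Astep.\<close>
  define V where "V i = A i + \<kappa> / 28 * G i" for i
  have V: "V i \<le> (1 - \<kappa> / 2) ^ i * V 0" for i
  proof (induction i)
    case (Suc i)
    have "V (Suc i) \<le> ((1 - \<kappa>) * A i + \<kappa> * G i / 59) + \<kappa> / 28 * (G i / 60 + 14 * A i)"
      unfolding V_def using \<kappa>01 by (intro add_mono mult_left_mono Astep Gstep) auto
    also have "\<dots> = (1 - \<kappa> / 2) * A i + (28 / 59 + 1 / 60) * (\<kappa> / 28 * G i)"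
      by (simp add: algebra_simps)
    \<comment> \<open>The exponent 60 makes \<open>28 / 59 + 1 / 60\<close> smaller than
      \<open>1 / 2\<close>, well below the contraction factor.\<close>
    also have "\<dots> \<le> (1 - \<kappa> / 2) * A i + (1 - \<kappa> / 2) * (\<kappa> / 28 * G i)"
      using \<kappa>01 G0[of i] by (intro add_left_mono mult_right_mono) auto
    also have "\<dots> = (1 - \<kappa> / 2) * V i" by (simp add: V_def algebra_simps)
    also have "\<dots> \<le> (1 - \<kappa> / 2) * ((1 - \<kappa> / 2) ^ i * V 0)"
      using \<kappa>01 Suc by (intro mult_left_mono) auto
    finally show ?case by simp
  qed simp
  have pr: "prime p" if "p \<in> primes_in 0 (w 0)" for p using that by (simp add: primes_in_def)
  define \<rho> where "\<rho> = euler_prod (primes_in 0 (w 0))"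
  have \<rho>: "\<rho> > 0" by (simp add: \<rho>_def)
  have P: "s > 0 \<and> prime_factors s \<subseteq> primes_in 0 (w 0)" if "s \<in> bad_set w e X 0" for s
    using that by (auto simp: bad_set_def)
  \<comment> \<open>At the start the mass is a probability and the log-mass at most the mean 14, so
    \<open>V 0 \<le> 1 + \<kappa> / 2\<close>.\<close>
  have A_0: "A 0 \<le> 1"
    using sum_inverse_le_euler_prod[OF fin P] \<rho> by (simp add: A_def mass_def \<rho>_def[symmetric] field_simps)
  have "(\<Sum>s\<in>bad_set w e X 0. ln (real s) / real s) \<le> log_sum (primes_in 0 (w 0)) / \<rho>"
    using sum_over_P_numbers_le[OF _ pr fin P, where \<alpha> = 0 and \<beta> = 1] by (simp add: \<rho>_def)
  also have "\<dots> \<le> 14 * ln (real (w 0)) / \<rho>" using \<rho> w0 by (intro divide_right_mono log_sum_le) auto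
  finally have "G 0 \<le> 14"
    using \<rho> w0 by (simp add: G_def log_mass_def \<rho>_def[symmetric] field_simps)
  hence "\<kappa> / 28 * G 0 \<le> \<kappa> / 28 * 14" using \<kappa>01 by (intro mult_left_mono) auto
  hence "V 0 \<le> 2" unfolding V_def using A_0 \<kappa>01 by linarith
  have "A i \<le> V i" unfolding V_def using \<kappa>01 G0[of i] by simp
  also have "\<dots> \<le> (1 - \<kappa> / 2) ^ i * V 0" by (rule V)
  also have "\<dots> \<le> (1 - \<kappa> / 2) ^ i * 2" using \<open>V 0 \<le> 2\<close> \<kappa>01 by (intro mult_left_mono) auto
  finally show ?thesis by (simp add: A_def)
qed

text \<open>If the square of the smooth part at \<open>w J\<close> exceeds \<open>X\<close>, the
  first moment bound applies. Otherwise that smooth part \<open>s\<close> is a bad number with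
  \<open>s * w J \<le> X\<close>, and the sieve turns the mass of the bad set into a count.\<close>

lemma card_no_gap_le:
  fixes w :: "nat \<Rightarrow> nat"
  assumes w0: "w 0 \<ge> 2" and w_Suc: "\<And>i. w (Suc i) = w i ^ 60" and e: "e * real (w 0) \<ge> 1"
    and \<kappa>: "\<kappa> = 1 / (180 * exp 14)" and X: "(w J)\<^sup>2 \<le> X"
  shows "real (card {m\<in>{1..X}. \<forall>j\<le>J. real (smooth_part (w j) m) > e * real (w j)})
    \<le> 28 * ln (real (w J)) / ln (real X) * real X + 30 * exp 14 * real X * (1 - \<kappa> / 2) ^ J"
proof -
  let ?B = "{m\<in>{1..X}. \<forall>j\<le>J. real (smooth_part (w j) m) > e * real (w j)}"
  let ?M = "{m\<in>{1..X}. (smooth_part (w J) m)\<^sup>2 > X}"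
  define D where "D = {s\<in>bad_set w e X J. s\<^sup>2 \<le> X}"
  have mono: "w i \<le> w j" if "i \<le> j" for i j by (rule tower_mono[of w 60]) (use w_Suc that in auto)
  have wJ: "w J \<ge> 2" using mono[of 0 J] w0 by simp
  have "w J * 1 \<le> w J * w J" using wJ by (intro mult_left_mono) auto
  hence X2: "X \<ge> 2" using X wJ unfolding power2_eq_square by linarith
  have "?B \<subseteq> ?M \<union> {m\<in>{1..X}. smooth_part (w J) m \<in> D}"
  proof
    fix m assume m: "m \<in> ?B"
    have sm: "smooth_part (w j) (smooth_part (w J) m) = smooth_part (w j) m" if "j \<le> J" for j
    proof -
      have "{..w j} \<inter> {..w J} = {..w j}" using mono[OF that] by auto
      thus ?thesis by (simp add: part_part)
    qed
    have "smooth_part (w J) m \<in> bad_set w e X J"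
      using m sm part_le[of m "{..w J}"] prime_factors_smooth_part[of "w J" m] part_pos[of "{..w J}" m]
      unfolding bad_set_def by (auto simp: Suc_le_eq)
    thus "m \<in> ?M \<union> {m\<in>{1..X}. smooth_part (w J) m \<in> D}" using m by (auto simp: D_def)
  qed
  hence "card ?B \<le> card (?M \<union> {m\<in>{1..X}. smooth_part (w J) m \<in> D})"
    by (intro card_mono) auto
  also have "\<dots> \<le> card ?M + card {m\<in>{1..X}. smooth_part (w J) m \<in> D}" by (rule card_Un_le)
  finally have "real (card ?B) \<le> real (card ?M) + real (card {m\<in>{1..X}. smooth_part (w J) m \<in> D})"
    by simp
  also have "real (card ?M) \<le> 28 * ln (real (w J)) / ln (real X) * real X"
    using card_large_smooth_part_le[OF wJ X2] X2 by (simp add: field_simps)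
  also have "real (card {m\<in>{1..X}. smooth_part (w J) m \<in> D}) 
     \<le> 15 * exp 14 * real X * (euler_prod (primes_in 0 (w J)) * (\<Sum>s\<in>D. 1 / real s))"
  proof (rule card_smooth_part_in_le[OF wJ])
    show "finite D" by (simp add: D_def bad_set_def)
    fix s assume s: "s \<in> D"
    have "(s * w J)\<^sup>2 \<le> X\<^sup>2"
      using s X by (simp add: D_def power_mult_distrib power2_eq_square[of X] mult_mono)
    thus "s > 0 \<and> s * w J \<le> X" using s by (auto simp: D_def bad_set_def power2_le_iff_abs_le dest: power2_le_imp_le)
  qed
  also have "euler_prod (primes_in 0 (w J)) * (\<Sum>s\<in>D. 1 / real s) \<le> mass (w J) (bad_set w e X J)"
    unfolding mass_def
    by (intro mult_left_mono sum_mono2) (auto simp: D_def bad_set_def less_imp_le)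
  also have "mass (w J) (bad_set w e X J) \<le> 2 * (1 - \<kappa> / 2) ^ J"
    by (rule mass_bad_set_le) (use assms in auto)
  finally show ?thesis by (simp add: mult_left_mono)
qed

section \<open>Descending sets of primes\<close>

text \<open>The set \<open>{p 1, \<dots>, p k}\<close> in \<open>LG_example\<close>: the prefix product up to the prime \<open>a\<close> is the product
  of the elements \<open>b \<ge> a\<close>, and \<open>p k\<close> is the minimum.\<close>
definition admissible :: "real \<Rightarrow> nat set \<Rightarrow> bool" where
  "admissible x A \<longleftrightarrow> finite A \<and> A \<noteq> {} \<and> (\<forall>a\<in>A. prime a) \<and>
     (\<forall>a\<in>A. a \<noteq> Min A \<longrightarrow> real a \<le> x / real (\<Prod>{b\<in>A. b \<ge> a})) \<and>
     x / real (\<Prod>A) < real (Min A)"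

text \<open>Strict descent makes \<open>p\<close> injective, and the prefix ending at
  \<open>p i\<close> consists of the elements \<open>\<ge> p i\<close>; the indices
  \<open>i < k\<close> are the non-minimal elements.\<close>

lemma LG_example_imp_admissible:
  assumes "n \<in> LG_example \<delta> x"
  obtains A where "admissible x A" "n = \<Prod>A"
proof -
  from assms obtain k :: nat and p :: "nat \<Rightarrow> nat" where kp: "k \<ge> 1" "n = (\<Prod>j=1..k. p j)" "\<forall>i\<in>{1..k}. prime (p i :: nat)"
    "\<forall>i\<in>{1..<k}. p i > p (i + 1)" "\<forall>i\<in>{1..<k}. x / real (\<Prod>j=1..i. p j) \<ge> real (p i)"
    "x / real (\<Prod>j=1..k. p j) < real (p k)"
    unfolding LG_example_def mem_Collect_eq by (elim conjE exE) (rule that, assumption+)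
  have less: "p j < p i" if "1 \<le> i" "i < j" "j \<le> k" for i j
    using that(2,3)
  proof (induction j)
    case (Suc j)
    have "p (Suc j) < p j" using kp(4) Suc.prems that(1) by auto
    thus ?case using Suc by (cases "i = j") auto
  qed simp
  have inj: "inj_on p {1..i}" if "i \<le> k" for i
    using less that by (intro linorder_inj_onI) (force simp: less_imp_neq)+
  define A where "A = p ` {1..k}"
  have pre: "{b\<in>A. b \<ge> p i} = p ` {1..i}" if i: "i \<in> {1..k}" for i
  proof -
    have "p i \<le> p j \<longleftrightarrow> j \<le> i" if "j \<in> {1..k}" for j
      using less[of i j] less[of j i] i that by (cases i j rule: linorder_cases) auto
    thus ?thesis using i unfolding A_def by force
  qed
  have prod_pre: "\<Prod>{b\<in>A. b \<ge> p i} = (\<Prod>j=1..i. p j)" if "i \<in> {1..k}" for i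
    using pre[OF that] inj[of i] that by (simp add: prod.reindex)
  have min: "Min A = p k"
  proof (rule Min_eqI)
    fix y assume "y \<in> A"
    then obtain j where "j \<in> {1..k}" "y = p j" by (auto simp: A_def)
    thus "y \<ge> p k" using less[of j k] by (cases "j = k") auto
  qed (use kp(1) in \<open>auto simp: A_def\<close>)
  have prodA: "\<Prod>A = (\<Prod>j=1..k. p j)"
    unfolding A_def using inj[of k] by (simp add: prod.reindex)
  have "admissible x A"
    unfolding admissible_def
  proof (intro conjI ballI impI)
    fix a assume a: "a \<in> A" "a \<noteq> Min A"
    then obtain i where i: "i \<in> {1..k}" "a = p i" by (auto simp: A_def)
    hence "i \<in> {1..<k}" using a min by (cases "i = k") auto
    thus "real a \<le> x / real (\<Prod>{b\<in>A. b \<ge> a})" using kp(5) prod_pre[OF i(1)] i by simp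
  qed (use kp min prodA in \<open>auto simp: A_def\<close>)
  thus ?thesis using that prodA kp(2) by simp
qed

lemma admissible_imp_LG_example:
  assumes "admissible x A" "real (\<Prod>A) \<le> x" "real (Min A) > x powr \<delta>"
  shows "\<Prod>A \<in> LG_example \<delta> x"
proof -
  have A: "finite A" "A \<noteq> {}" "\<And>a. a \<in> A \<Longrightarrow> prime a"
    using assms(1) by (auto simp: admissible_def)
  define k where "k = card A"
  have k: "k \<ge> 1" using A by (simp add: k_def Suc_le_eq card_gt_0_iff)
  \<comment> \<open>The list ascends and is indexed from 0, so position \<open>k - i\<close> puts
    the largest prime at \<open>i = 1\<close> and the smallest at \<open>i = k\<close>.\<close>
  define p where "p i = sorted_list_of_set A ! (k - i)" for i
  have len: "length (sorted_list_of_set A) = k" by (simp add: k_def)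
  have less: "p j < p i" if "1 \<le> i" "i < j" "j \<le> k" for i j
    unfolding p_def using that strict_sorted_list_of_set[of A] len
    by (intro sorted_wrt_nth_less[of "(<)"]) auto
  have img: "p ` {1..k} = A"
  proof -
    have "A = (\<lambda>i. sorted_list_of_set A ! i) ` {0..<k}"
      using set_sorted_list_of_set[OF A(1)] nth_image[of k "sorted_list_of_set A"] len 
      by (simp add: atLeast0LessThan)
    also have "{0..<k} = (\<lambda>i. k - i) ` {1..k}"
    proof -
      have "i \<in> (\<lambda>i. k - i) ` {1..k}" if "i < k" for i
        using that by (intro image_eqI[of _ _ "k - i"]) auto
      thus ?thesis using k by auto
    qed
    finally show ?thesis by (simp add: image_image p_def)
  qed
  have inj: "inj_on p {1..i}" if "i \<le> k" for i
    using less that by (intro linorder_inj_onI) (force simp: less_imp_neq)+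
  have pre: "{b\<in>A. b \<ge> p i} = p ` {1..i}" if i: "i \<in> {1..k}" for i
  proof -
    have "p i \<le> p j \<longleftrightarrow> j \<le> i" if "j \<in> {1..k}" for j
      using less[of i j] less[of j i] i that by (cases i j rule: linorder_cases) auto
    thus ?thesis using i unfolding img[symmetric] by force
  qed
  have prod_pre: "\<Prod>{b\<in>A. b \<ge> p i} = (\<Prod>j=1..i. p j)" if "i \<in> {1..k}" for i
    using pre[OF that] inj[of i] that by (simp add: prod.reindex)
  have min: "Min A = p k"
  proof (rule Min_eqI)
    fix y assume "y \<in> A"
    then obtain j where "j \<in> {1..k}" "y = p j" by (auto simp: img[symmetric])
    thus "y \<ge> p k" using less[of j k] by (cases "j = k") auto
  qed (use k img A in auto)
  have prodA: "\<Prod>A = (\<Prod>j=1..k. p j)"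
    unfolding img[symmetric] using inj[of k] by (simp add: prod.reindex)
  have mem: "p i \<in> A" if "i \<in> {1..k}" for i using that img by auto
  have "\<Prod>A > 0" using A prime_gt_0_nat by (intro prod_pos) auto
  hence "0 < real (\<Prod>A)" by (simp del: of_nat_prod)
  hence "1 \<le> x / real (\<Prod>A)" using assms(2) by (simp add: le_divide_eq_1_pos del: of_nat_prod)
  moreover have "x / real (\<Prod>j=1..i. p j) \<ge> real (p i)" if "i \<in> {1..<k}" for i
  proof -
    have "p i \<noteq> Min A" using less[of i k] that min by auto
    moreover have i: "i \<in> {1..k}" using that by auto
    ultimately have "real (p i) \<le> x / real (\<Prod>{b\<in>A. b \<ge> p i})"
      using assms(1) mem[OF i] unfolding admissible_def by blast
    thus ?thesis using prod_pre[OF i] by simp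
  qed
  moreover have "p i > p (i + 1)" if "i \<in> {1..<k}" for i using less[of i "i + 1"] that by auto
  moreover have "prime (p i)" if "i \<in> {1..k}" for i using A(3) mem[OF that] .
  ultimately have "1 \<le> k \<and> \<Prod>A = (\<Prod>j=1..k. p j) \<and> (\<forall>i\<in>{1..k}. prime (p i)) \<and>
            (\<forall>i\<in>{1..<k}. p i > p (i + 1)) \<and>
            real (p k) > x powr \<delta> \<and>
            (\<forall>i\<in>{1..<k}. x / real (\<Prod>j=1..i. p j) \<ge> real (p i)) \<and>
            1 \<le> x / real (\<Prod>j=1..k. p j) \<and>
            x / real (\<Prod>j=1..k. p j) < real (p k)"
    using assms k min prodA unfolding admissible_def by auto
  thus ?thesis using assms(2) unfolding LG_example_def by blast
qed

section \<open>Least common multiples of members of the example\<close>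

text \<open>\<open>d\<close> is the first prime, in descending order, at which the two sets differ.
  It is coprime to the product of \<open>B\<close> and exceeds \<open>Min B\<close>, so the lcm is
  at least \<open>d * \<Prod>B\<close>, which beats \<open>x\<close> by the stopping inequality of
  \<open>B\<close>.\<close>

lemma admissible_lcm_aux:
  assumes A: "admissible x A" and B: "admissible x B"
    and d: "d \<in> A" "d \<notin> B" "\<And>b. b > d \<Longrightarrow> b \<in> A \<longleftrightarrow> b \<in> B"
  shows "real (lcm (\<Prod>A) (\<Prod>B)) > x"
proof -
  have fin: "finite A" "finite B" "B \<noteq> {}" and prA: "\<And>a. a \<in> A \<Longrightarrow> prime a" and prB: "\<And>a. a \<in> B \<Longrightarrow> prime a"
    using A B by (auto simp: admissible_def)
  have minB: "Min B \<in> B" using fin by simp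
  have posB: "\<Prod>B > 0" using prB prime_gt_0_nat by (intro prod_pos) auto
  have posA: "\<Prod>A > 0" using prA prime_gt_0_nat by (intro prod_pos) auto
  \<comment> \<open>Otherwise \<open>B\<close> is a proper initial segment of \<open>A\<close> in
    descending order; at the prime \<open>Min B\<close> the set \<open>A\<close> demands
    continuation while \<open>B\<close> demands a stop, for the same prefix product.\<close>
  have "Min B < d"
  proof (rule ccontr)
    assume "\<not> Min B < d"
    hence gt: "b > d" if "b \<in> B" for b using that fin d(2) Min_le[OF fin(2) that]
      by (metis le_less_trans le_neq_implies_less not_less)
    hence sub: "B \<subseteq> A" using d(3) by auto
    have "Min B \<noteq> Min A" using Min_le[OF fin(1) d(1)] gt[OF minB] by auto
    hence "real (Min B) \<le> x / real (\<Prod>{b\<in>A. b \<ge> Min B})"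
      using A sub minB unfolding admissible_def by auto
    moreover have "{b\<in>A. b \<ge> Min B} = B"
      using sub d(3) gt[OF minB] Min_le[OF fin(2)] by force
    ultimately show False using B unfolding admissible_def by auto
  qed
  have "coprime d (\<Prod>B)"
  proof (rule prod_coprime_right)
    fix b assume "b \<in> B"
    thus "coprime d b" using prA[OF d(1)] prB d(2) primes_coprime by metis
  qed
  moreover have "d dvd \<Prod>A" using fin d(1) dvd_prodI[of A d "\<lambda>x. x"] by simp
  ultimately have "d * \<Prod>B dvd lcm (\<Prod>A) (\<Prod>B)"
    by (intro divides_mult) (auto intro: dvd_lcmI1)
  hence "d * \<Prod>B \<le> lcm (\<Prod>A) (\<Prod>B)" using posA posB by (intro dvd_imp_le lcm_pos_nat)
  have "x < real (Min B) * real (\<Prod>B)"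
  proof -
    have "x / real (\<Prod>B) < real (Min B)" using B unfolding admissible_def by blast
    moreover have "0 < real (\<Prod>B)" using posB by (simp del: of_nat_prod)
    ultimately show ?thesis by (simp only: pos_divide_less_eq)
  qed
  moreover have "real (Min B) * real (\<Prod>B) \<le> real d * real (\<Prod>B)"
    using \<open>Min B < d\<close> by (intro mult_right_mono of_nat_0_le_iff) simp
  moreover have "real d * real (\<Prod>B) \<le> real (lcm (\<Prod>A) (\<Prod>B))"
    using \<open>d * \<Prod>B \<le> lcm (\<Prod>A) (\<Prod>B)\<close> by (metis of_nat_le_iff of_nat_mult)
  ultimately show ?thesis by linarith
qed

lemma LG_example_lcm:
  assumes "n1 \<in> LG_example \<delta> x" "n2 \<in> LG_example \<delta> x" "n1 \<noteq> n2"
  shows "real (lcm n1 n2) > x"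
proof -
  obtain A where A: "admissible x A" "n1 = \<Prod>A" using assms(1) by (rule LG_example_imp_admissible)
  obtain B where B: "admissible x B" "n2 = \<Prod>B" using assms(2) by (rule LG_example_imp_admissible)
  define S where "S = (A - B) \<union> (B - A)"
  have S: "finite S" "S \<noteq> {}" using A B assms(3) by (auto simp: S_def admissible_def)
  \<comment> \<open>In descending order the first difference is the largest element of the symmetric
    difference.\<close>
  define d where "d = Max S"
  have "d \<in> S" using S by (simp add: d_def)
  have eq: "b \<in> A \<longleftrightarrow> b \<in> B" if "b > d" for b
  proof -
    have "b \<notin> S" using that Max_ge[OF S(1), of b] unfolding d_def by auto
    thus ?thesis by (auto simp: S_def)
  qed
  show ?thesis
  proof (cases "d \<in> A")
    case True
    hence "d \<notin> B" using \<open>d \<in> S\<close> by (auto simp: S_def)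
    thus ?thesis using admissible_lcm_aux[OF A(1) B(1) True _ eq] A(2) B(2) by simp
  next
    case False
    hence "d \<in> B" using \<open>d \<in> S\<close> by (auto simp: S_def)
    thus ?thesis using admissible_lcm_aux[OF B(1) A(1) _ False] eq A(2) B(2) by (simp add: lcm.commute)
  qed
qed

lemma LG_example_ge_2:
  assumes "n \<in> LG_example \<delta> x" shows "n \<ge> 2"
proof -
  obtain A where A: "admissible x A" "n = \<Prod>A" using assms by (rule LG_example_imp_admissible)
  then obtain a where a: "a \<in> A" by (auto simp: admissible_def)
  have "\<Prod>A > 0" using A prime_gt_0_nat by (intro prod_pos) (auto simp: admissible_def)
  moreover have "a dvd \<Prod>A" using A a by (auto simp: admissible_def)
  moreover have "a \<ge> 2" using A a prime_ge_2_nat by (auto simp: admissible_def)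
  ultimately show ?thesis using A(2) by (metis dvd_imp_le order.trans)
qed

section \<open>Divisors of a given integer in the example\<close>

text \<open>Read the primes of \<open>m\<close> beyond \<open>w\<close> downwards and stop at the
  first \<open>q\<close> with \<open>x / Q q < q\<close>. The least prime beyond \<open>W\<close>
  satisfies this, as \<open>e * x < m\<close> and \<open>smooth_part W m \<le> e * W\<close>, so a
  stop occurs.\<close>

lemma covered_by_LG_example:
  assumes m: "m > 0" "real m \<le> x" "real m > e * x" and e: "0 < e" "e \<le> 1"
    and gap: "real (smooth_part W m) \<le> e * real W" and "w \<le> W" "real W \<le> x" 
    and w: "x powr \<delta> \<le> real w"
    and sqf: "\<And>p. prime p \<Longrightarrow> real p > x powr \<delta> \<Longrightarrow> \<not> p\<^sup>2 dvd m"
    and v: "real (smooth_part w m) \<ge> x powr (1 - c)"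
  shows "\<exists>n\<in>LG_example \<delta> x. real n \<le> x powr c \<and> n dvd m"
proof -
  define S where "S = prime_factors m \<inter> {w<..}"
  have S: "finite S" "\<And>p. p \<in> S \<Longrightarrow> prime p" by (auto simp: S_def)
  have x: "x > 0" using m by (smt (verit) of_nat_0_less_iff)
  have mult1: "multiplicity p m = 1" if "p \<in> S" for p
  proof -
    have p: "prime p" "p dvd m" "p > w" using that by (auto simp: S_def)
    have "real p > x powr \<delta>" using p w by linarith
    hence "\<not> p ^ Suc 1 dvd m" using sqf[OF p(1)] by (simp add: power2_eq_square)
    thus ?thesis using p m(1) by (intro multiplicity_eqI) auto
  qed
  define Q where "Q q = \<Prod>{b\<in>S. b \<ge> q}" for q
  have dvdw: "\<Prod>T dvd part {w<..} m" if "T \<subseteq> S" for T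
  proof -
    have "\<Prod>T dvd \<Prod>S" using S(1) that by (rule prod_dvd_prod_subset)
    also have "\<Prod>S = part {w<..} m"
      unfolding part_def S_def[symmetric] by (intro prod.cong) (auto simp: mult1)
    finally show ?thesis .
  qed
  have compl: "smooth_part u m * part {u<..} m = m" for u
  proof -
    have "- {..u} = {u<..}" by auto
    thus ?thesis using part_mult_compl[OF m(1), of "{..u}"] by simp
  qed
  define G where "G = {q\<in>S. x / real (Q q) < real q}"
  define T where "T = S \<inter> {W<..}"
  have partT: "part {W<..} m = \<Prod>T"
  proof -
    have "prime_factors m \<inter> {W<..} = T" using \<open>w \<le> W\<close> by (auto simp: S_def T_def)
    thus ?thesis unfolding part_def by (intro prod.cong) (auto simp: mult1 T_def)
  qed
  \<comment> \<open>Without primes beyond \<open>W\<close>, \<open>m\<close> is its own smooth part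
    and at most \<open>e * W \<le> e * x\<close>.\<close>
  have "T \<noteq> {}"
  proof
    assume "T = {}"
    hence "smooth_part W m = m" using compl[of W] partT by simp
    hence "real m \<le> e * x" using gap \<open>real W \<le> x\<close> e by (smt (verit) mult_left_mono)
    thus False using m by simp
  qed
  define q0 where "q0 = Min T"
  have finT: "finite T" using S by (simp add: T_def)
  have q0: "q0 \<in> T" using finT \<open>T \<noteq> {}\<close> by (simp add: q0_def)
  have Qq0: "Q q0 = \<Prod>T"
  proof -
    have "{b\<in>S. b \<ge> q0} = T" using q0 Min_le[OF finT] by (auto simp: T_def q0_def)
    thus ?thesis by (simp add: Q_def)
  qed
  have "q0 \<in> G"
  proof -
    have pos: "real (\<Prod>T) > 0" using S finT prime_gt_0_nat by (auto simp: T_def intro!: prod_pos)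
    have "e * x < real (smooth_part W m) * real (\<Prod>T)"
      using m(3) compl[of W] partT by (metis of_nat_mult)
    also have "\<dots> \<le> e * real W * real (\<Prod>T)" using gap pos by (intro mult_right_mono) auto
    finally have "x < real W * real (\<Prod>T)" using e by (simp add: mult.assoc)
    also have "\<dots> \<le> real q0 * real (\<Prod>T)" using q0 pos by (intro mult_right_mono) (auto simp: T_def)
    finally show ?thesis using q0 pos by (simp add: G_def T_def Qq0 field_simps)
  qed
  \<comment> \<open>The largest element of \<open>G\<close> is the first stopping point, so all
    larger primes satisfy the continuation inequality.\<close>
  define q where "q = Max G"
  have G: "finite G" using S by (simp add: G_def)
  have q: "q \<in> G" using G \<open>q0 \<in> G\<close> by (metis Max_in empty_iff q_def)
  define A where "A = {b\<in>S. b \<ge> q}"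
  have qS: "q \<in> S" using q by (simp add: G_def)
  have minA: "Min A = q" using S qS by (intro Min_eqI) (auto simp: A_def)
  have "admissible x A"
    unfolding admissible_def
  proof (intro conjI ballI impI)
    fix a assume a: "a \<in> A" "a \<noteq> Min A"
    hence "a > q" using minA by (auto simp: A_def)
    hence "a \<notin> G" using Max_ge[OF G, of a] by (auto simp: q_def)
    hence "real a \<le> x / real (Q a)" using a by (auto simp: G_def A_def)
    moreover have "{b\<in>A. b \<ge> a} = {b\<in>S. b \<ge> a}" using \<open>a > q\<close> by (auto simp: A_def)
    ultimately show "real a \<le> x / real (\<Prod>{b\<in>A. b \<ge> a})" by (simp add: Q_def)
  next
    show "x / real (\<Prod>A) < real (Min A)" using q minA by (simp add: G_def Q_def A_def)
  qed (use S qS in \<open>auto simp: A_def\<close>)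
  \<comment> \<open>The cofactor of the divisor contains the whole smooth part, which is at least
    \<open>x powr (1 - c)\<close>; this forces the divisor below \<open>x powr c\<close>.\<close>
  have "\<Prod>A dvd part {w<..} m" by (rule dvdw) (auto simp: A_def)
  hence dv: "smooth_part w m * \<Prod>A dvd m" using compl[of w] by (metis mult_dvd_mono dvd_refl)
  hence "smooth_part w m * \<Prod>A \<le> m" using m(1) by (rule dvd_imp_le)
  hence "real (smooth_part w m) * real (\<Prod>A) \<le> x" using m(2) by (metis of_nat_le_iff of_nat_mult order.trans)
  hence "x powr (1 - c) * real (\<Prod>A) \<le> x" using v by (smt (verit) mult_right_mono of_nat_0_le_iff)
  also have "x = x powr (1 - c) * x powr c" using x by (simp flip: powr_add)
  finally have le: "real (\<Prod>A) \<le> x powr c" using x by simp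
  have dm: "\<Prod>A dvd m" using dv by (metis dvd_mult_right)
  hence "real (\<Prod>A) \<le> x" using m by (meson dvd_imp_le of_nat_le_iff order.trans)
  moreover have "real (Min A) > x powr \<delta>" using qS w minA by (auto simp: S_def)
  ultimately have "\<Prod>A \<in> LG_example \<delta> x" using \<open>admissible x A\<close> by (intro admissible_imp_LG_example)
  thus ?thesis using le dm by blast
qed

section \<open>Counting uncovered integers\<close>

text \<open>A union bound over four exceptional sets: \<open>B3\<close> costs
  \<open>2 * e * x\<close>, the others \<open>e * x\<close> each. The assumptions \<open>wJ\<close>
  and \<open>J\<close> control the two terms for \<open>B3\<close>, and \<open>v\<close> controls
  \<open>B4\<close>.\<close>

lemma card_uncovered_le:
  fixes w :: "nat \<Rightarrow> nat"
  assumes e: "0 < e" "e \<le> 1" and x: "x \<ge> 2"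
    and w0: "w 0 \<ge> 2" and w_Suc: "\<And>i. w (Suc i) = w i ^ 60" and ew: "e * real (w 0) \<ge> 1"
    and wx: "x powr \<delta> \<le> real (w 0)" and D: "D = nat \<lfloor>x powr \<delta>\<rfloor>" "e * real D \<ge> 1"
    and X: "X = nat \<lfloor>x\<rfloor>"
    and wJ: "28 * ln (real (w J)) \<le> e * ln (real X)"
    and J: "30 * exp 14 * (1 - 1 / (180 * exp 14) / 2) ^ J \<le> e"
    and c: "c < 1" and \<eta>: "1 - c \<le> \<delta>"
    and v: "15 * exp 14 * (1 + (1 - c) * ln x) \<le> e * ln (real (w 0))"
  shows "real (card {m. 1 \<le> m \<and> real m \<le> x \<and> 
     \<not> (\<exists>n\<in>LG_example \<delta> x. real n \<le> x powr c \<and> n dvd m)}) \<le> 5 * e * x"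
proof -
  have X2: "X \<ge> 2" "real X \<le> x" using x by (auto simp: X le_nat_iff le_floor_iff)
  have Xiff: "real m \<le> x \<longleftrightarrow> m \<le> X" for m
    using x by (simp add: X le_nat_iff le_floor_iff)
  have lnX: "ln (real X) > 0" using X2 by simp
  have mono: "w i \<le> w j" if "i \<le> j" for i j by (rule tower_mono[of w 60]) (use w_Suc that in auto)
  have wJ2: "w J \<ge> 2" using mono[of 0 J] w0 by simp
  have lnwJ: "ln (real (w J)) > 0" using wJ2 by simp
  have wJX: "(w J)\<^sup>2 \<le> X"
  proof -
    have "e * ln (real X) \<le> 1 * ln (real X)" using e lnX by (intro mult_right_mono) auto
    hence "2 * ln (real (w J)) \<le> ln (real X)" using wJ lnwJ by linarith
    hence "ln (real (w J) ^ 2) \<le> ln (real X)" by (simp add: ln_realpow)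
    hence "real (w J) ^ 2 \<le> real X" using wJ2 X2 by simp
    thus ?thesis by (metis of_nat_le_iff of_nat_power)
  qed
  have wjX: "w j \<le> X" if "j \<le> J" for j
  proof -
    have "w j \<le> w J" by (rule mono[OF that])
    also have "w J \<le> (w J)\<^sup>2" by (simp add: power2_eq_square)
    finally show ?thesis using wJX by simp
  qed
  define V where "V = nat \<lfloor>x powr (1 - c)\<rfloor>"
  have x1c: "x powr (1 - c) \<ge> 1" using x c by (intro ge_one_powr_ge_zero) auto
  have V1: "V \<ge> 1" using x1c by (simp add: V_def le_nat_iff le_floor_iff)
  have Vle: "real V \<le> x powr (1 - c)" unfolding V_def using x1c by (simp add: of_nat_nat)
  \<comment> \<open>Room for the sieve in the bound for \<open>B4\<close>:
    \<open>V \<le> x powr \<delta> \<le> w 0 \<le> w J\<close>.\<close>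
  have VwX: "V * w 0 \<le> X"
  proof -
    have "x powr (1 - c) \<le> x powr \<delta>" using x by (intro powr_mono \<eta>) auto
    hence "real V \<le> x powr \<delta>" using Vle by linarith
    hence "V \<le> w 0" using wx by linarith
    hence "V * w 0 \<le> w J * w J" using mono[of 0 J] by (intro mult_mono) auto
    thus ?thesis using wJX by (simp add: power2_eq_square)
  qed
  have D1: "D \<ge> 1" using D(2) by (cases D) auto

  define U where "U = {m. 1 \<le> m \<and> real m \<le> x \<and> \<not> (\<exists>n\<in>LG_example \<delta> x. real n \<le> x powr c \<and> n dvd m)}"
  \<comment> \<open>Each set collects the \<open>m\<close> violating one hypothesis of
    \<open>covered_by_LG_example\<close>; \<open>B2\<close> allows all \<open>d > D\<close>, in
    particular the primes above \<open>x powr \<delta>\<close>.\<close>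
  define B1 where "B1 = {m\<in>{1..X}. real m \<le> e * x}"
  define B2 where "B2 = {m\<in>{1..X}. \<exists>d>D. d\<^sup>2 dvd m}"
  define B3 where "B3 = {m\<in>{1..X}. \<forall>j\<le>J. real (smooth_part (w j) m) > e * real (w j)}"
  define B4 where "B4 = {m\<in>{1..X}. smooth_part (w 0) m \<le> V}"
  have "U \<subseteq> (B1 \<union> B2) \<union> (B3 \<union> B4)"
  proof (rule ccontr)
    assume "\<not> ?thesis"
    then obtain m where m: "m \<in> U" "m \<notin> B1" "m \<notin> B2" "m \<notin> B3" "m \<notin> B4" by auto
    have mX: "m \<in> {1..X}" "real m \<le> x" "m > 0" using m(1) by (auto simp: U_def Xiff)
    obtain j where j: "j \<le> J" "real (smooth_part (w j) m) \<le> e * real (w j)"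
      using m(4) mX by (auto simp: B3_def not_less)
    have "\<exists>n\<in>LG_example \<delta> x. real n \<le> x powr c \<and> n dvd m"
    proof (rule covered_by_LG_example[OF mX(3,2) _ e j(2) mono[of 0 j] _ wx])
      show "real m > e * x" using m(2) mX by (auto simp: B1_def)
      show "real (w j) \<le> x" using wjX[OF j(1)] Xiff by simp
      fix p :: nat assume p: "prime p" "real p > x powr \<delta>"
      have "D < p" using p(2) D(1) by (simp add: nat_less_iff floor_less_iff)
      thus "\<not> p\<^sup>2 dvd m" using m(3) mX by (auto simp: B2_def)
    next
      have "V < smooth_part (w 0) m" using m(5) mX by (auto simp: B4_def)
      hence "x powr (1 - c) < real (smooth_part (w 0) m)" 
        unfolding V_def by (simp add: nat_less_iff floor_less_iff)
      thus "x powr (1 - c) \<le> real (smooth_part (w 0) m)" by simp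
    qed simp
    thus False using m(1) by (auto simp: U_def)
  qed
  hence "card U \<le> card ((B1 \<union> B2) \<union> (B3 \<union> B4))"
    by (intro card_mono) (auto simp: B1_def B2_def B3_def B4_def)
  also have "\<dots> \<le> (card B1 + card B2) + (card B3 + card B4)"
    by (intro order.trans[OF card_Un_le] add_mono card_Un_le)
  finally have "real (card U) \<le> real (card B1) + real (card B2) + real (card B3) + real (card B4)" by linarith
  also have "real (card B1) \<le> e * x"
  proof -
    have "B1 \<subseteq> {1..nat \<lfloor>e * x\<rfloor>}"
      by (auto simp: B1_def le_nat_iff le_floor_iff)
    hence "card B1 \<le> nat \<lfloor>e * x\<rfloor>" using card_mono[of "{1..nat \<lfloor>e * x\<rfloor>}" B1] by simp
    thus ?thesis using e x by (simp add: le_nat_iff le_floor_iff)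
  qed
  also have "real (card B2) \<le> e * x"
  proof -
    have "real (card B2) \<le> real X / real D" unfolding B2_def by (rule card_square_multiples_le[OF D1])
    also have "\<dots> \<le> e * real X" using D1 mult_right_mono[OF D(2), of "real X"]
      by (simp add: divide_le_eq mult_ac)
    also have "\<dots> \<le> e * x" using e X2 by simp
    finally show ?thesis .
  qed
  also have "real (card B3) \<le> 2 * e * x"
  proof -
    have "real (card B3) \<le> 28 * ln (real (w J)) / ln (real X) * real X + 30 * exp 14 * real X * (1 - 1 / (180 * exp 14) / 2) ^ J"
      unfolding B3_def by (rule card_no_gap_le[of w e "1 / (180 * exp 14)", OF w0 w_Suc ew refl wJX])
    also have "\<dots> = (28 * ln (real (w J)) / ln (real X) + 30 * exp 14 * (1 - 1 / (180 * exp 14) / 2) ^ J) * real X"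
      by (simp add: distrib_right)
    also have "\<dots> \<le> (e + e) * real X"
      using wJ lnX by (intro mult_right_mono add_mono J) (auto simp: divide_le_eq)
    also have "\<dots> \<le> (e + e) * x" using e X2 by simp
    finally show ?thesis by simp
  qed
  also have "real (card B4) \<le> e * x"
  proof -
    have "ln (real V) \<le> ln (x powr (1 - c))" using Vle V1 by (intro ln_mono) auto
    also have "\<dots> = (1 - c) * ln x" using x by (simp add: ln_powr)
    finally have lnV: "ln (real V) \<le> (1 - c) * ln x" .
    have "real (card B4) * ln (real (w 0)) \<le> 15 * exp 14 * real X * (1 + ln (real V))"
      unfolding B4_def by (rule card_small_smooth_part_le[OF w0 V1 VwX])
    also have "\<dots> \<le> 15 * exp 14 * real X * (1 + (1 - c) * ln x)"
      using lnV by (intro mult_left_mono) auto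
    also have "\<dots> = (15 * exp 14 * (1 + (1 - c) * ln x)) * real X" by simp
    also have "\<dots> \<le> (e * ln (real (w 0))) * real X" by (intro mult_right_mono v) auto
    also have "\<dots> = (e * real X) * ln (real (w 0))" by simp
    finally have "real (card B4) \<le> e * real X" using w0 by simp
    also have "\<dots> \<le> e * x" using e X2 by simp
    finally show ?thesis .
  qed
  finally show ?thesis by (simp add: U_def)
qed

section \<open>Choice of the constants\<close>

lemma LG_set_LG_example:
  assumes "0 < \<epsilon>" "\<epsilon> < 1"
  obtains c \<delta> where "0 < c" "c < 1" "0 < \<delta>" "\<delta> < 1" "\<forall>\<^sub>F x in at_top. LG_set \<epsilon> c x (LG_example \<delta> x)"
proof -
  \<comment> \<open>The total loss will be \<open>5 * e * x\<close>.\<close>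
  define e where "e = \<epsilon> / 5"
  have e: "0 < e" "e < 1" using assms by (auto simp: e_def)
  define r :: real where "r = 1 - 1 / (180 * exp 14) / 2"
  define K :: real where "K = exp 14"
  have K: "K \<ge> 1" by (simp add: K_def)
  have r: "0 < r" "r < 1" using K by (auto simp: r_def K_def[symmetric] field_simps)
  have "(\<lambda>J. 30 * K * r ^ J) \<longlonglongrightarrow> 30 * K * 0"
    using r by (intro tendsto_intros LIMSEQ_realpow_zero) auto
  hence "\<forall>\<^sub>F J in sequentially. 30 * K * r ^ J < e" using e by (intro order_tendstoD(2)) auto
  then obtain J where J: "30 * K * r ^ J < e" using eventually_happens'[OF sequentially_bot] by blast
  \<comment> \<open>Since \<open>ln (w J)\<close> is at most
    \<open>60 ^ J * 2 * \<delta> * ln x\<close>, this gives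
    \<open>28 * ln (w J) \<le> e * (ln x / 2) \<le> e * ln X\<close>. The number \<open>J\<close> of
    scales is fixed before, so all constants depend on \<open>\<epsilon>\<close> only.\<close>
  define \<delta> where "\<delta> = e / (112 * 60 ^ J)"
  have \<delta>: "0 < \<delta>" "\<delta> \<le> e"
  proof -
    have "(1::real) \<le> 112 * 60 ^ J" using one_le_power[of "60::real" J] by linarith
    thus "\<delta> \<le> e" using e by (simp add: \<delta>_def divide_le_eq mult_left_mono[of 1, simplified])
  qed (use e in \<open>auto simp: \<delta>_def\<close>)
  \<comment> \<open>\<open>\<eta> = 1 - c\<close>, chosen so that
    \<open>15 * K * (2 * \<eta> * ln x) = e * \<delta> * ln x\<close>.\<close>
  define \<eta> where "\<eta> = e * \<delta> / (30 * K)"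
  have "\<eta> > 0" using e \<delta> K by (simp add: \<eta>_def)
  moreover have "\<eta> \<le> \<delta>"
  proof -
    have "e * \<delta> \<le> (30 * K) * \<delta>" using e K \<delta> by (intro mult_right_mono) auto
    thus ?thesis using K by (simp add: \<eta>_def divide_le_eq mult.commute)
  qed
  ultimately have \<eta>: "0 < \<eta>" "\<eta> \<le> \<delta>" by blast+
  have "\<forall>\<^sub>F x in at_top. LG_set \<epsilon> (1 - \<eta>) x (LG_example \<delta> x)"
  proof -
    have ev1: "\<forall>\<^sub>F x in at_top. x \<ge> (2::real)" by (rule eventually_ge_at_top)
    \<comment> \<open>\<open>ev2\<close> gives \<open>e * D \<ge> 1\<close>, \<open>ev3\<close> and
      \<open>ev4\<close> absorb the rounding in \<open>w 0\<close> and \<open>X\<close>, and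
      \<open>ev5\<close> absorbs the summand 1 in \<open>1 + \<eta> * ln x\<close>.\<close>
    have ev2: "\<forall>\<^sub>F x in at_top. x powr \<delta> \<ge> 2 / e + 2" using \<delta> by real_asymp
    have ev3: "\<forall>\<^sub>F x in at_top. x powr \<delta> + 1 \<le> x powr (2 * \<delta>)" using \<delta> by real_asymp
    have ev4: "\<forall>\<^sub>F x::real in at_top. ln x / 2 \<le> ln (x - 1)" by real_asymp
    have ev5: "\<forall>\<^sub>F x in at_top. 1 \<le> \<eta> * ln x" using \<eta> by real_asymp
    from ev1 ev2 ev3 ev4 ev5 show ?thesis
    proof eventually_elim
      case (elim x)
      \<comment> \<open>Closed form of the tower: the power associates to the right, so the exponent
        is \<open>60 ^ i\<close>.\<close>
      define w where "w i = nat \<lceil>x powr \<delta>\<rceil> ^ 60 ^ i" for i :: nat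
      define D where "D = nat \<lfloor>x powr \<delta>\<rfloor>"
      define X where "X = nat \<lfloor>x\<rfloor>"
      have xd: "x powr \<delta> \<ge> 2" using elim(2) e by (smt (verit) divide_pos_pos)
      have w0: "w 0 = nat \<lceil>x powr \<delta>\<rceil>" by (simp add: w_def)
      have w0_ge: "x powr \<delta> \<le> real (w 0)" unfolding w0 by (rule real_nat_ceiling_ge)
      have w0_le: "real (w 0) \<le> x powr \<delta> + 1" unfolding w0 using xd by linarith
      have w02: "w 0 \<ge> 2" using w0_ge xd by linarith
      have lnx: "ln x > 0" using elim by simp
      have "ln (real (w 0)) \<le> ln (x powr (2 * \<delta>))"
        using w0_le elim w02 by (intro ln_mono) auto
      hence lnw0: "ln (real (w 0)) \<le> 2 * \<delta> * ln x" using elim by (simp add: ln_powr)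
      have "x - 1 \<le> real X" using elim unfolding X_def by linarith
      hence "ln (x - 1) \<le> ln (real X)" using elim by (intro ln_mono) auto
      hence lnX: "ln x / 2 \<le> ln (real X)" using elim by linarith
      have wJ: "28 * ln (real (w J)) \<le> e * ln (real X)"
      proof -
        have "ln (real (w J)) = 60 ^ J * ln (real (w 0))"
          using w02 by (simp add: w_def ln_realpow)
        also have "\<dots> \<le> 60 ^ J * (2 * \<delta> * ln x)" by (intro mult_left_mono lnw0) auto
        also have "\<dots> = e * (ln x / 2) / 28" by (simp add: \<delta>_def)
        also have "\<dots> \<le> e * ln (real X) / 28" using e lnX by (intro divide_right_mono mult_left_mono) auto
        finally show ?thesis by simp
      qed
      have eD: "e * real D \<ge> 1"
      proof -
        have "real D \<ge> 2 / e" using elim(2) e unfolding D_def by linarith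
        hence "e * real D \<ge> e * (2 / e)" using e by (intro mult_left_mono) auto
        thus ?thesis using e by simp
      qed
      have ew: "e * real (w 0) \<ge> 1"
      proof -
        have "real D \<le> real (w 0)" using w0_ge xd unfolding D_def by linarith
        hence "e * real D \<le> e * real (w 0)" using e by (intro mult_left_mono) auto
        thus ?thesis using eD by linarith
      qed
      have v: "15 * exp 14 * (1 + (1 - (1 - \<eta>)) * ln x) \<le> e * ln (real (w 0))"
      proof -
        have "15 * K * (1 + \<eta> * ln x) \<le> 15 * K * (2 * (\<eta> * ln x))"
          using elim(5) K by (intro mult_left_mono) auto
        also have "\<dots> = e * (\<delta> * ln x)" using K by (simp add: \<eta>_def)
        also have "\<delta> * ln x = ln (x powr \<delta>)" using elim by (simp add: ln_powr)
        also have "e * ln (x powr \<delta>) \<le> e * ln (real (w 0))"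
          using e xd w0_ge by (intro mult_left_mono ln_mono) auto
        finally show ?thesis by (simp add: K_def)
      qed
      have "real (card {m. 1 \<le> m \<and> real m \<le> x \<and> 
         \<not> (\<exists>n\<in>LG_example \<delta> x. real n \<le> x powr (1 - \<eta>) \<and> n dvd m)}) \<le> 5 * e * x"
      proof (rule card_uncovered_le[where w = w and J = J and D = D and X = X])
        show "w (Suc i) = w i ^ 60" for i by (simp add: w_def mult.commute flip: power_mult)
        show "30 * exp 14 * (1 - 1 / (180 * exp 14) / 2) ^ J \<le> e" using J by (simp add: K_def r_def)
      qed (use e elim w02 w0_ge ew wJ v \<eta> eD D_def X_def in auto)
      moreover have "real n \<le> x" if "n \<in> LG_example \<delta> x" for n
        using that by (simp add: LG_example_def)
      ultimately show ?case
        unfolding LG_set_def using LG_example_lcm LG_example_ge_2 by (auto simp: e_def)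
    qed
  qed
  thus ?thesis using \<eta> \<delta> e by (intro that[of "1 - \<eta>" \<delta>]) auto
qed

theorem theorem1:
  "\<exists>\<epsilon>0::real. \<epsilon>0 > 0 \<and>
     (\<forall>\<epsilon>::real. 0 < \<epsilon> \<and> \<epsilon> < \<epsilon>0 \<longrightarrow>
        (\<exists>c \<delta> :: real. 0 < c \<and> c < 1 \<and> 0 < \<delta> \<and> \<delta> < 1 \<and>
           (\<forall>\<^sub>F x::real in at_top.
              \<exists>N. N \<subseteq> {n. 1 \<le> n \<and> real n \<le> x} \<and> LG_set \<epsilon> c x N) \<and>
           (\<forall>\<^sub>F x::real in at_top. LG_set \<epsilon> c x (LG_example \<delta> x))))"
proof (rule exI[of _ 1], intro conjI allI impI)
  \<comment> \<open>The threshold 1 suffices, as the constants are constructed for every positive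
    \<open>\<epsilon> < 1\<close>.\<close>
  fix \<epsilon> :: real assume \<epsilon>: "0 < \<epsilon> \<and> \<epsilon> < 1"
  obtain c \<delta> where *: "0 < c" "c < 1" "0 < \<delta>" "\<delta> < 1"
    and ev: "\<forall>\<^sub>F x in at_top. LG_set \<epsilon> c x (LG_example \<delta> x)"
    using LG_set_LG_example[of \<epsilon>] \<epsilon> by blast
  from ev have "\<forall>\<^sub>F x in at_top. \<exists>N. N \<subseteq> {n. 1 \<le> n \<and> real n \<le> x} \<and> LG_set \<epsilon> c x N"
  proof eventually_elim
    case (elim x)
    hence "LG_example \<delta> x \<subseteq> {n. 1 \<le> n \<and> real n \<le> x}" by (fastforce simp: LG_set_def)
    thus ?case using elim by blast
  qed
  thus "\<exists>c \<delta> :: real. 0 < c \<and> c < 1 \<and> 0 < \<delta> \<and> \<delta> < 1 \<and>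
           (\<forall>\<^sub>F x::real in at_top.
              \<exists>N. N \<subseteq> {n. 1 \<le> n \<and> real n \<le> x} \<and> LG_set \<epsilon> c x N) \<and>
           (\<forall>\<^sub>F x::real in at_top. LG_set \<epsilon> c x (LG_example \<delta> x))"
    using * ev by blast
qed simp

end
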